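(* Let $\mathbf{x}=\mathbf{A}\boldsymbol{\theta}_0+\mathbf{v}$ be the linear model of the context, with assumptions A1, A2, A6 and A7 of the context in force, and let $\hat{\boldsymbol{\theta}}^N_0=(\mathbf{A}^T\mathbf{A})^{-1}\mathbf{A}^T\mathbf{x}$ be the least squares estimator. Let $\varepsilon>0$ and $r>0$ be given. Then for all $N>N(r,\varepsilon)$, $$P\left(\|\hat{\boldsymbol{\theta}}^N_0-\boldsymbol{\theta}_0\|_\infty>r\right)<\varepsilon,$$ where $$N(r,\varepsilon)=\max\left\{\frac{8\alpha^2b^2}{r^2\sigma_{min}^2}\log\frac{2p}{\varepsilon},\ \frac{4}{3}\,\frac{(6\sigma_{max}+\sigma_{min})(p\alpha^2+\sigma_{max})}{\sigma_{min}^2}\log\frac{2p}{\varepsilon}\right\}.$$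
   Context: Model: $\mathbf{x}=\mathbf{A}\boldsymbol{\theta}_0+\mathbf{v}$, where $\mathbf{x}\in\mathbb{R}^{N\times 1}$ is the output, $\mathbf{A}=(a_{ni})\in\mathbb{R}^{N\times p}$ is a random matrix with rows $\mathbf{a}_n^T$, $n=1,\dots,N$, $\boldsymbol{\theta}_0\in\mathbb{R}^p$ is the true parameter, $\mathbf{v}=(v_1,\dots,v_N)^T$ is the noise, and $N$ is the number of samples. Standing assumptions: the noise is zero mean, $N>p$, and the least squares solution exists ($\mathbf{A}^T\mathbf{A}$ is invertible). $\lambda_{max}(\mathbf B)$ and $\lambda_{min}(\mathbf B)$ denote the largest and smallest eigenvalues of a square matrix $\mathbf B$. Assumptions: A1: $P(|a_{ni}|\le\alpha)=1$ for all $n=1,\dots,N$ and $i=1,\dots,p$. A2: there is a matrix $\mathbf{M}\in\mathbb{R}^{p\times p}$ with $\mathbf{M}=\frac1N E(\mathbf{A}^T\mathbf{A})$ for all $N>0$; write $\sigma_{max}=\lambda_{max}(\mathbf{M})$ and $\sigma_{min}=\lambda_{min}(\mathbf{M})$, with $\sigma_{min}>0$. A6: $(v_n)$ is a martingale difference sequence with respect to a filtration $(F_n)$ (so $v_n$ is $F_n$-measurable), i.e. $E(v_n\mid F_{n-1})=0$, and the $v_n$ are independent of $\mathbf{A}$. A7: $P(|v_n|\le b)=1$ for all $n$.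
   Formalization: The formal statement adds that the rows a_n of A are mutually independent (not identically distributed); without this the claim fails, e.g. p=1 with all rows equal to one random variable taking values 1/100 and 1. *)

theory Defs
  imports "HOL-Probability.Probability"
begin

text \<open>
  A matrix \<open>A\<close> with \<open>N\<close> rows in \<open>real^'p\<close>, \<open>N\<close> varying, is the initial segment
  \<open>A 1, ..., A N\<close> of a sequence of rows; the value at index \<open>0\<close> is never used.
  The same convention applies to vectors of length \<open>N\<close>.
\<close>

definition gram_matrix :: "nat \<Rightarrow> (nat \<Rightarrow> real^'p) \<Rightarrow> real^'p^'p" where
  "gram_matrix N A = (\<chi> i j. \<Sum>n=1..N. A n $ i * A n $ j)"

definition transpose_apply :: "nat \<Rightarrow> (nat \<Rightarrow> real^'p) \<Rightarrow> (nat \<Rightarrow> real) \<Rightarrow> real^'p" where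
  "transpose_apply N A y = (\<chi> i. \<Sum>n=1..N. A n $ i * y n)"

definition least_squares :: "nat \<Rightarrow> (nat \<Rightarrow> real^'p) \<Rightarrow> (nat \<Rightarrow> real) \<Rightarrow> real^'p" where
  "least_squares N A y = matrix_inv (gram_matrix N A) *v transpose_apply N A y"

text \<open>Real eigenvalues; the maximum and minimum are meaningful for symmetric matrices.\<close>

definition eigenvalues :: "real^'p^'p \<Rightarrow> real set" where
  "eigenvalues B = {l. \<exists>u. u \<noteq> 0 \<and> B *v u = l *\<^sub>R u}"

definition lambda_max :: "real^'p^'p \<Rightarrow> real" where
  "lambda_max B = Max (eigenvalues B)"

definition lambda_min :: "real^'p^'p \<Rightarrow> real" where
  "lambda_min B = Min (eigenvalues B)"

text \<open>Like \<open>indep_var\<close>, which forces both variables to have the same value type.\<close>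

definition indep_rv ::
  "'w measure \<Rightarrow> 'a measure \<Rightarrow> ('w \<Rightarrow> 'a) \<Rightarrow> 'b measure \<Rightarrow> ('w \<Rightarrow> 'b) \<Rightarrow> bool" where
  "indep_rv P S X T Y \<longleftrightarrow>
     X \<in> measurable P S \<and> Y \<in> measurable P T \<and>
     prob_space.indep_set P {X -` B \<inter> space P | B. B \<in> sets S}
       {Y -` B \<inter> space P | B. B \<in> sets T}"

definition martingale_difference ::
  "'w measure \<Rightarrow> (nat \<Rightarrow> 'w measure) \<Rightarrow> (nat \<Rightarrow> 'w \<Rightarrow> real) \<Rightarrow> bool" where
  "martingale_difference P F v \<longleftrightarrow>
     filtration (space P) F \<and> (\<forall>n. subalgebra P (F n)) \<and>
     (\<forall>n\<ge>1. v n \<in> borel_measurable (F n) \<and> integrable P (v n) \<and>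
        (AE w in P. real_cond_exp P (F (n - 1)) (v n) w = 0))"

definition sample_bound :: "real^'p^'p \<Rightarrow> real \<Rightarrow> real \<Rightarrow> real \<Rightarrow> real \<Rightarrow> real" where
  "sample_bound M \<alpha> b r \<epsilon> =
     (let p = real CARD('p); smax = lambda_max M; smin = lambda_min M in
      max (8 * \<alpha>\<^sup>2 * b\<^sup>2 / (r\<^sup>2 * smin\<^sup>2) * ln (2 * p / \<epsilon>))
          (4 / 3 * ((6 * smax + smin) * (p * \<alpha>\<^sup>2 + smax) / smin\<^sup>2) * ln (2 * p / \<epsilon>)))"

text \<open>
  In the theorem the rows of the random matrix are assumed to be mutually independent (not
  identically distributed), as is implicit in calling \<open>N\<close> the number of samples.  Without
  this the bound fails: for \<open>p = 1\<close> let all rows equal one variable taking the values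
  \<open>1/100\<close> and \<open>1\<close> with probability \<open>1/2\<close> each, let the noise be independent fair signs,
  \<open>\<alpha> = b = r = 1\<close> and \<open>\<epsilon> = 1/10\<close>.  Then \<open>N = 97\<close> exceeds the bound, but the error exceeds
  \<open>r\<close> with probability at least \<open>1/2\<close>.
\<close>

end

theory Submission
  imports Defs
begin

text \<open>
  Write \<open>p\<close> for the dimension, \<open>\<sigma>\<close> for \<open>lambda_min M\<close>, \<open>R = p \<alpha>\<^sup>2\<close> and
  \<open>L = ln (2 * p / \<epsilon>)\<close>; only \<open>\<epsilon> \<le> 1\<close> is of interest.  The error of the estimator solves
  \<open>S e = A\<^sup>T v\<close> with \<open>S = A\<^sup>T A\<close>.  There are two ways to fail, each of probability at
  most \<open>\<epsilon> / 2\<close>, the first one strictly so.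

  First, the least eigenvalue of \<open>S\<close> may be smaller than \<open>s = N \<sigma> / 2\<close>.  This is controlled by a
  Laplace transform argument for the trace of \<open>exp (- t S)\<close>, in which the exponential is replaced
  by the power \<open>h ^^ m\<close> of \<open>h = id - c S\<close> with \<open>m c = t\<close> and \<open>c\<close> small.  Adding one row
  changes \<open>h\<close> by a rank-one operator, and \<open>trace_power_rank_one_update\<close> bounds the decrease of
  the trace from below to second order in \<open>t\<close>.  Its proof needs no noncommutative trace
  inequality: it only uses that the moments \<open>x \<bullet> (h ^^ n) x\<close> form a log-convex sequence.
  Independence of the rows turns the decrease into a factor \<open>exp (- \<beta> \<sigma>)\<close> per row, and the
  Markov inequality yields \<open>prob_trace_power_shrink_ge\<close>: the probability is at most
  \<open>p * exp (- 3 / 28 * N * \<sigma> / R)\<close>.  As the largest eigenvalue is at least \<open>\<sigma>\<close>, the second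
  term of \<open>sample_bound\<close> makes this less than \<open>p * exp (- L) = \<epsilon> / 2\<close>.

  Second, let \<open>S\<close> be at least \<open>s\<close>.  As the noise is independent of the rows, these may be
  frozen (\<open>prob_le_of_indep_rv\<close>).  Each coordinate of the error is then a sum of the martingale
  differences with deterministic weights whose squares add up to at most \<open>1 / s\<close>
  (\<open>solution_coefficients\<close>), and \<open>Azuma_Hoeffding\<close> applies.  Since \<open>\<sigma> \<le> \<alpha>\<^sup>2\<close>, the first term
  of \<open>sample_bound\<close> provides the exponent \<open>2 * L\<close>, and the union over the coordinates has
  probability at most \<open>2 * p * exp (- 2 * L) = \<epsilon>\<^sup>2 / (2 * p) \<le> \<epsilon> / 2\<close>.
\<close>

section \<open>Log-convex sequences\<close>

text \<open>
  Log-convexity says that the ratios \<open>f (Suc l) / f l\<close> increase; this is that statement with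
  the denominators cleared.
\<close>
lemma log_convex_ratio_mono:
  fixes f :: "nat \<Rightarrow> real"
  assumes pos: "\<And>n. f n > 0" and conv: "\<And>n. (f (Suc n))\<^sup>2 \<le> f n * f (Suc (Suc n))"
    and "l \<le> k"
  shows "f (Suc l) * f k \<le> f l * f (Suc k)"
  using \<open>l \<le> k\<close>
proof (induction k rule: dec_induct)
  case base
  then show ?case by simp
next
  case (step k)
  have "(f (Suc l) * f (Suc k)) * f k = (f (Suc l) * f k) * f (Suc k)" by simp
  also have "\<dots> \<le> (f l * f (Suc k)) * f (Suc k)"
    using step.IH pos[of "Suc k"] by (intro mult_right_mono) auto
  also have "\<dots> = f l * (f (Suc k))\<^sup>2" by (simp add: power2_eq_square)
  also have "\<dots> \<le> f l * (f k * f (Suc (Suc k)))"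
    using conv[of k] pos[of l] by (intro mult_left_mono) auto
  finally have "(f (Suc l) * f (Suc k)) * f k \<le> (f l * f (Suc (Suc k))) * f k"
    by (simp add: mult_ac)
  then show ?case using pos[of k] by simp
qed

lemma log_convex_mult_le:
  fixes f :: "nat \<Rightarrow> real"
  assumes pos: "\<And>n. f n > 0" and conv: "\<And>n. (f (Suc n))\<^sup>2 \<le> f n * f (Suc (Suc n))"
  shows "f j * f l \<le> f 0 * f (j + l)"
proof (induction l)
  case 0
  then show ?case by simp
next
  case (Suc l)
  have "(f j * f (Suc l)) * f (j + l) = f j * (f (Suc l) * f (j + l))" by simp
  also have "\<dots> \<le> f j * (f l * f (Suc (j + l)))"
    using log_convex_ratio_mono[of f l "j + l"] pos conv pos[of j]
    by (intro mult_left_mono) (auto intro: less_imp_le)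
  also have "\<dots> = (f j * f l) * f (Suc (j + l))" by simp
  also have "\<dots> \<le> (f 0 * f (j + l)) * f (Suc (j + l))"
    using Suc.IH pos[of "Suc (j + l)"] by (intro mult_right_mono) auto
  finally have "(f j * f (Suc l)) * f (j + l) \<le> (f 0 * f (Suc (j + l))) * f (j + l)"
    by (simp add: mult_ac)
  then show ?case using pos[of "j + l"] by simp
qed

lemma log_convex_power_le:
  fixes f :: "nat \<Rightarrow> real"
  assumes pos: "\<And>n. f n > 0" and conv: "\<And>n. (f (Suc n))\<^sup>2 \<le> f n * f (Suc (Suc n))"
    and "f 0 = 1"
  shows "f 1 ^ n \<le> f n"
proof (induction n)
  case (Suc n)
  have "f 1 ^ Suc n \<le> f 1 * f n" using Suc pos[of 1] by simp
  also have "\<dots> \<le> f (Suc n)" using log_convex_mult_le[of f 1 n] pos conv \<open>f 0 = 1\<close> by simp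
  finally show ?case .
qed (simp add: assms)

section \<open>Moments of positive contractions\<close>

definition trace_power :: "('a::euclidean_space \<Rightarrow> 'a) \<Rightarrow> nat \<Rightarrow> real" where
  "trace_power h m = (\<Sum>e\<in>Basis. e \<bullet> (h ^^ m) e)"

text \<open>
  The operators to which this applies are \<open>h = id - c S\<close> with \<open>S\<close> a Gram operator and \<open>c\<close>
  small, so that \<open>h ^^ m\<close> imitates the exponential of \<open>- m c S\<close>.  There the lower bound \<open>\<delta>\<close> is
  close to \<open>1\<close>; being positive, it makes all moments positive and lets consecutive powers of \<open>h\<close> be compared.
\<close>
locale positive_contraction =
  fixes h :: "'a::euclidean_space \<Rightarrow> 'a" and \<delta> :: real
  assumes lin: "linear h"
    and self_adjoint: "h x \<bullet> y = x \<bullet> h y"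
    and \<delta>_pos: "0 < \<delta>"
    and lower: "\<delta> * (x \<bullet> x) \<le> x \<bullet> h x"
    and upper: "x \<bullet> h x \<le> x \<bullet> x"
begin

lemma nonneg: "0 \<le> x \<bullet> h x"
  using lower[of x] \<delta>_pos by (smt (verit) inner_ge_zero mult_nonneg_nonneg)

lemma power_self_adjoint: "(h ^^ n) x \<bullet> y = x \<bullet> (h ^^ n) y"
  by (induction n arbitrary: x y) (auto simp: self_adjoint funpow_swap1)

lemma moment_add: "x \<bullet> (h ^^ (j + l)) x = (h ^^ j) x \<bullet> (h ^^ l) x"
  by (simp add: funpow_add power_self_adjoint)

lemma Cauchy_Schwarz: "(x \<bullet> h y)\<^sup>2 \<le> (x \<bullet> h x) * (y \<bullet> h y)"
proof (cases "y = 0")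
  case True
  then show ?thesis using linear_0[OF lin] by simp
next
  case False
  have y: "y \<bullet> h y > 0"
    using False lower[of y] \<delta>_pos by (smt (verit) inner_gt_zero_iff mult_pos_pos)
  let ?t = "(x \<bullet> h y) / (y \<bullet> h y)"
  have yx: "y \<bullet> h x = x \<bullet> h y" by (metis self_adjoint inner_commute)
  have "0 \<le> (x - ?t *\<^sub>R y) \<bullet> h (x - ?t *\<^sub>R y)" by (rule nonneg)
  also have "\<dots> = x \<bullet> h x - 2 * ?t * (x \<bullet> h y) + ?t\<^sup>2 * (y \<bullet> h y)"
    by (simp add: linear_diff[OF lin] linear_cmul[OF lin] inner_diff_left inner_diff_right yx
        power2_eq_square algebra_simps)
  also have "\<dots> = x \<bullet> h x - (x \<bullet> h y)\<^sup>2 / (y \<bullet> h y)"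
    using y by (simp add: power2_eq_square field_simps)
  finally show ?thesis using y by (simp add: field_simps)
qed

lemma image_norm_le: "h x \<bullet> h x \<le> x \<bullet> h x"
proof (cases "h x = 0")
  case False
  have "(h x \<bullet> h x)\<^sup>2 = (x \<bullet> h (h x))\<^sup>2" by (simp add: self_adjoint)
  also have "\<dots> \<le> (x \<bullet> h x) * (h x \<bullet> h (h x))" by (rule Cauchy_Schwarz)
  also have "\<dots> \<le> (x \<bullet> h x) * (h x \<bullet> h x)"
    by (intro mult_left_mono upper nonneg)
  finally show ?thesis using False by (simp add: power2_eq_square)
qed simp

lemma even_split: "x \<bullet> (h ^^ (2 * q)) x = (h ^^ q) x \<bullet> (h ^^ q) x"
  using moment_add[of x q q] by (simp add: mult_2)

lemma odd_split: "x \<bullet> (h ^^ Suc (2 * q)) x = (h ^^ q) x \<bullet> h ((h ^^ q) x)"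
  using moment_add[of x q "Suc q"] by (simp add: mult_2)

lemma moment_nonneg: "0 \<le> x \<bullet> (h ^^ n) x"
  by (cases "even n") (auto elim!: evenE oddE simp del: funpow.simps simp: even_split odd_split nonneg)

lemma moment_Suc_lower: "\<delta> * (x \<bullet> (h ^^ (2 * q)) x) \<le> x \<bullet> (h ^^ Suc (2 * q)) x"
  unfolding even_split odd_split by (rule lower)

lemma moment_decreasing: "x \<bullet> (h ^^ Suc (Suc (2 * q))) x \<le> x \<bullet> (h ^^ Suc (2 * q)) x"
proof -
  have "Suc (Suc (2 * q)) = 2 * Suc q" by simp
  then have "x \<bullet> (h ^^ Suc (Suc (2 * q))) x = (h ^^ Suc q) x \<bullet> (h ^^ Suc q) x"
    by (simp only: even_split)
  also have "\<dots> \<le> (h ^^ q) x \<bullet> h ((h ^^ q) x)" using image_norm_le by simp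
  finally show ?thesis by (simp only: odd_split)
qed

lemma power_norm_le: "(h ^^ n) x \<bullet> (h ^^ n) x \<le> x \<bullet> x"
proof (induction n)
  case (Suc n)
  have "(h ^^ Suc n) x \<bullet> (h ^^ Suc n) x \<le> (h ^^ n) x \<bullet> h ((h ^^ n) x)"
    using image_norm_le by simp
  also have "\<dots> \<le> (h ^^ n) x \<bullet> (h ^^ n) x" by (rule upper)
  finally show ?case using Suc by simp
qed simp

lemma power_nonzero: "x \<noteq> 0 \<Longrightarrow> (h ^^ n) x \<noteq> 0"
proof (induction n)
  case (Suc n)
  have "h y \<noteq> 0" if "y \<noteq> 0" for y
    using that lower[of y] \<delta>_pos by (smt (verit) inner_gt_zero_iff inner_zero_right mult_pos_pos)
  then show ?case using Suc by simp
qed simp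

lemma moment_pos:
  assumes "x \<noteq> 0"
  shows "0 < x \<bullet> (h ^^ n) x"
proof (cases "even n")
  case True
  then show ?thesis using power_nonzero[OF assms] by (auto elim!: evenE simp: even_split)
next
  case False
  then obtain q where n: "n = Suc (2 * q)" by (auto elim: oddE)
  let ?y = "(h ^^ q) x"
  have "0 < \<delta> * (?y \<bullet> ?y)" using power_nonzero[OF assms] \<delta>_pos by simp
  then show ?thesis unfolding n odd_split using lower[of ?y] by linarith
qed

text \<open>
  This is the Cauchy--Schwarz inequality, for the inner product when \<open>n\<close> is even and for the
  form \<open>x \<bullet> h y\<close> when \<open>n\<close> is odd.  It stands in for the spectral theorem, which would
  present the moments as those of a measure on the spectrum of \<open>h\<close>.
\<close>
lemma moment_log_convex:
  "(x \<bullet> (h ^^ Suc n) x)\<^sup>2 \<le> (x \<bullet> (h ^^ n) x) * (x \<bullet> (h ^^ Suc (Suc n)) x)"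
proof (cases "even n")
  case True
  then obtain q where n: "n = 2 * q" by (auto elim: evenE)
  have n2: "Suc (Suc n) = 2 * Suc q" by (simp add: n)
  have "(x \<bullet> (h ^^ Suc n) x) = (h ^^ q) x \<bullet> (h ^^ Suc q) x"
    unfolding n odd_split by simp
  moreover have "x \<bullet> (h ^^ Suc (Suc n)) x = (h ^^ Suc q) x \<bullet> (h ^^ Suc q) x"
    unfolding n2 even_split ..
  moreover have "x \<bullet> (h ^^ n) x = (h ^^ q) x \<bullet> (h ^^ q) x"
    unfolding n even_split ..
  ultimately show ?thesis
    by (simp only: Cauchy_Schwarz_ineq)
next
  case False
  then obtain q where n: "n = Suc (2 * q)" by (auto elim: oddE)
  have n2: "Suc (Suc n) = Suc (2 * Suc q)" "Suc n = 2 * Suc q" by (simp_all add: n)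
  have "(x \<bullet> (h ^^ Suc n) x) = (h ^^ q) x \<bullet> h ((h ^^ Suc q) x)"
    unfolding n2 even_split by (simp add: self_adjoint)
  moreover have "x \<bullet> (h ^^ Suc (Suc n)) x = (h ^^ Suc q) x \<bullet> h ((h ^^ Suc q) x)"
    unfolding n2(1) odd_split ..
  moreover have "x \<bullet> (h ^^ n) x = (h ^^ q) x \<bullet> h ((h ^^ q) x)"
    unfolding n odd_split ..
  ultimately show ?thesis
    by (simp only: Cauchy_Schwarz)
qed

lemma moment_mult_le:
  "(x \<bullet> (h ^^ j) x) * (x \<bullet> (h ^^ l) x) \<le> (x \<bullet> x) * (x \<bullet> (h ^^ (j + l)) x)"
proof (cases "x = 0")
  case False
  then show ?thesis
    using log_convex_mult_le[of "\<lambda>n. x \<bullet> (h ^^ n) x" j l] moment_pos[OF False] moment_log_convex[of x]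
    by simp
qed simp

text \<open>
  Jensen's inequality for the spectral measure of \<open>u\<close>, obtained from log-convexity.
\<close>
lemma moment_power_le:
  assumes "norm u = 1"
  shows "(u \<bullet> h u) ^ n \<le> u \<bullet> (h ^^ n) u"
proof -
  have "u \<noteq> 0" "u \<bullet> u = 1" using assms by (auto simp: norm_eq_1)
  then show ?thesis
    using log_convex_power_le[of "\<lambda>n. u \<bullet> (h ^^ n) u" n] moment_pos moment_log_convex[of u]
    by simp
qed

lemma trace_power_even: "trace_power h (2 * q) = (\<Sum>e\<in>Basis. (h ^^ q) e \<bullet> (h ^^ q) e)"
  unfolding trace_power_def even_split ..

lemma trace_power_even_bounds:
  shows "0 \<le> trace_power h (2 * q)" and "trace_power h (2 * q) \<le> DIM('a)"
proof -
  show "0 \<le> trace_power h (2 * q)" unfolding trace_power_even by (intro sum_nonneg) simp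
  have "trace_power h (2 * q) \<le> (\<Sum>e\<in>(Basis :: 'a set). 1)"
    unfolding trace_power_even
    by (intro sum_mono order.trans[OF power_norm_le]) (simp add: inner_same_Basis)
  then show "trace_power h (2 * q) \<le> DIM('a)" by simp
qed

text \<open>
  With \<open>moment_power_le\<close> this shows that a single direction in which \<open>h\<close> is large already
  forces a large trace.
\<close>
lemma moment_le_trace:
  assumes "norm u = 1"
  shows "u \<bullet> (h ^^ (2 * q)) u \<le> trace_power h (2 * q)"
proof -
  have "u \<bullet> (h ^^ (2 * q)) u = (\<Sum>e\<in>Basis. ((h ^^ q) u \<bullet> e)\<^sup>2)"
    unfolding even_split by (subst euclidean_inner) (simp add: power2_eq_square)
  also have "\<dots> \<le> (\<Sum>e\<in>Basis. (h ^^ q) e \<bullet> (h ^^ q) e)"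
  proof (rule sum_mono)
    fix e :: 'a
    have "((h ^^ q) u \<bullet> e)\<^sup>2 = (u \<bullet> (h ^^ q) e)\<^sup>2" by (simp add: power_self_adjoint)
    also have "\<dots> \<le> (u \<bullet> u) * ((h ^^ q) e \<bullet> (h ^^ q) e)" by (rule Cauchy_Schwarz_ineq)
    finally show "((h ^^ q) u \<bullet> e)\<^sup>2 \<le> (h ^^ q) e \<bullet> (h ^^ q) e"
      using assms by (simp add: norm_eq_1)
  qed
  finally show ?thesis by (simp add: trace_power_def even_split)
qed

end

section \<open>The trace of a power under a rank-one update\<close>

text \<open>
  The product rule along the segment from \<open>h\<close> to its rank-one perturbation.  The factors do not
  commute, so each of the \<open>m\<close> positions of the perturbation in the power contributes a term.
\<close>
lemma has_vector_derivative_power_path: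
  fixes h :: "'a::euclidean_space \<Rightarrow> 'a"
  assumes "linear h"
  shows "((\<lambda>s. ((\<lambda>z. h z - (s * c * (a \<bullet> z)) *\<^sub>R a) ^^ m) y) has_vector_derivative
     - c *\<^sub>R (\<Sum>j<m. (a \<bullet> ((\<lambda>z. h z - (s * c * (a \<bullet> z)) *\<^sub>R a) ^^ (m - 1 - j)) y) *\<^sub>R
        ((\<lambda>z. h z - (s * c * (a \<bullet> z)) *\<^sub>R a) ^^ j) a)) (at s within X)"
proof (induction m)
  case 0
  then show ?case by simp
next
  case (Suc m)
  define g where "g s z = h z - (s * c * (a \<bullet> z)) *\<^sub>R a" for s z
  let ?D = "- c *\<^sub>R (\<Sum>j<m. (a \<bullet> (g s ^^ (m - 1 - j)) y) *\<^sub>R (g s ^^ j) a)"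
  have ling: "linear (g s)"
    unfolding g_def using assms
    by (intro linearI) (auto simp: linear_add linear_cmul algebra_simps)
  have IH: "((\<lambda>s. (g s ^^ m) y) has_vector_derivative ?D) (at s within X)"
    using Suc.IH unfolding g_def .
  have blh: "bounded_linear h" using assms by (simp add: linear_conv_bounded_linear)
  note hIH = bounded_linear.has_vector_derivative[OF blh IH]
  note aIH = bounded_linear.has_vector_derivative[OF bounded_linear_inner_right[of a] IH]
  have aIH': "((\<lambda>s. a \<bullet> (g s ^^ m) y) has_real_derivative (a \<bullet> ?D)) (at s within X)"
    using aIH by (simp add: has_real_derivative_iff_has_vector_derivative)
  have mul: "((\<lambda>s. s * c * (a \<bullet> (g s ^^ m) y)) has_real_derivative
      c * (a \<bullet> (g s ^^ m) y) + s * c * (a \<bullet> ?D)) (at s within X)"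
    by (rule derivative_eq_intros aIH' refl | simp)+
  have "((\<lambda>s. g s ((g s ^^ m) y)) has_vector_derivative
      (h ?D - (s * c * (a \<bullet> ?D)) *\<^sub>R a - (c * (a \<bullet> (g s ^^ m) y)) *\<^sub>R a)) (at s within X)"
    unfolding g_def[of _ "(g _ ^^ m) y"]
    by (rule has_vector_derivative_eq_rhs)
      (rule has_vector_derivative_diff[OF hIH has_vector_derivative_scaleR[OF mul has_vector_derivative_const]],
       simp add: algebra_simps)
  moreover have "h ?D - (s * c * (a \<bullet> ?D)) *\<^sub>R a - (c * (a \<bullet> (g s ^^ m) y)) *\<^sub>R a
      = g s ?D - (c * (a \<bullet> (g s ^^ m) y)) *\<^sub>R a"
    by (simp add: g_def)
  moreover have "g s ?D = - c *\<^sub>R (\<Sum>j<m. (a \<bullet> (g s ^^ (m - 1 - j)) y) *\<^sub>R (g s ^^ Suc j) a)"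
    by (simp only: linear_cmul[OF ling] linear_sum[OF ling] funpow.simps o_apply)
  moreover have "\<dots> - (c * (a \<bullet> (g s ^^ m) y)) *\<^sub>R a
      = - c *\<^sub>R (\<Sum>j<Suc m. (a \<bullet> (g s ^^ (Suc m - 1 - j)) y) *\<^sub>R (g s ^^ j) a)"
    by (subst sum.lessThan_Suc_shift) (simp add: algebra_simps)
  ultimately have "((\<lambda>s. (g s ^^ Suc m) y) has_vector_derivative
      - c *\<^sub>R (\<Sum>j<Suc m. (a \<bullet> (g s ^^ (Suc m - 1 - j)) y) *\<^sub>R (g s ^^ j) a)) (at s within X)"
    by simp
  then show ?case unfolding g_def .
qed

text \<open>
  Cyclicity of the trace: under the trace all \<open>m\<close> terms of the product rule coincide.
\<close>
lemma (in positive_contraction) trace_product: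
  "(\<Sum>e\<in>Basis. (a \<bullet> (h ^^ j) e) * (e \<bullet> (h ^^ l) a)) = a \<bullet> (h ^^ (j + l)) a"
proof -
  have "a \<bullet> (h ^^ (j + l)) a = (\<Sum>e\<in>Basis. ((h ^^ j) a \<bullet> e) * ((h ^^ l) a \<bullet> e))"
    by (simp only: moment_add euclidean_inner[of "(h ^^ j) a" "(h ^^ l) a"])
  then show ?thesis by (simp add: power_self_adjoint inner_commute[of _ "(h ^^ l) a"])
qed

text \<open>
  This replaces the Golden--Thompson inequality for rank-one updates.  Let \<open>g s\<close> move linearly
  from \<open>h\<close> to the updated operator, \<open>T\<close> be the trace of \<open>g s ^^ m\<close>, and \<open>\<psi>\<close> the moment
  \<open>a \<bullet> (g s ^^ (m - 1)) a\<close>.  Then \<open>T' = - c m \<psi>\<close>.  The derivative of \<open>\<psi>\<close> is minus \<open>c\<close> times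
  a sum of products of two moments of total order \<open>m - 2\<close>, and log-convexity bounds each of them
  by \<open>a \<bullet> a\<close> times one moment of order \<open>m - 2\<close>, hence \<open>\<psi>' \<ge> - k \<psi>\<close> with
  \<open>k = m c (a \<bullet> a) / \<delta>\<close>.  Integrating twice gives the second-order bound stated.
\<close>
lemma trace_power_rank_one_update:
  fixes h :: "'a::euclidean_space \<Rightarrow> 'a"
  assumes h: "positive_contraction h \<delta>"
    and h': "positive_contraction (\<lambda>z. h z - (c * (a \<bullet> z)) *\<^sub>R a) \<delta>"
    and c: "0 \<le> c" and m: "even m" "0 < m"
    and small: "real m * c * (a \<bullet> a) \<le> 2 * \<delta>"
  shows "trace_power (\<lambda>z. h z - (c * (a \<bullet> z)) *\<^sub>R a) m
    \<le> trace_power h m - real m * c * (1 - real m * c * (a \<bullet> a) / (2 * \<delta>)) * (a \<bullet> (h ^^ m) a)"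
proof -
  interpret h: positive_contraction h \<delta> by (fact h)
  define g where "g s z = h z - (s * c * (a \<bullet> z)) *\<^sub>R a" for s z
  have g0: "g 0 = h" and g1: "g 1 = (\<lambda>z. h z - (c * (a \<bullet> z)) *\<^sub>R a)"
    by (auto simp: g_def)
  have pc: "positive_contraction (g s) \<delta>" if s: "0 \<le> s" "s \<le> 1" for s
  proof (rule positive_contraction.intro)
    show "linear (g s)"
      unfolding g_def using h.lin
      by (intro linearI) (auto simp: linear_add linear_cmul algebra_simps)
    show "g s x \<bullet> y = x \<bullet> g s y" for x y
      using h.self_adjoint[of x y] by (simp add: g_def inner_diff_left inner_diff_right inner_commute)
    show "0 < \<delta>" by (fact h.\<delta>_pos)
    have gx: "x \<bullet> g s x = x \<bullet> h x - s * (c * (a \<bullet> x)\<^sup>2)" for x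
      by (simp add: g_def algebra_simps power2_eq_square inner_commute)
    have nn: "0 \<le> c * (a \<bullet> x)\<^sup>2" for x using c by simp
    show "\<delta> * (x \<bullet> x) \<le> x \<bullet> g s x" for x
    proof -
      have "\<delta> * (x \<bullet> x) \<le> x \<bullet> h x - c * (a \<bullet> x)\<^sup>2"
        using positive_contraction.lower[OF h', of x]
        by (simp add: algebra_simps power2_eq_square inner_commute)
      also have "\<dots> \<le> x \<bullet> h x - s * (c * (a \<bullet> x)\<^sup>2)"
        using s nn[of x] by (simp add: mult_left_le_one_le)
      finally show ?thesis by (simp only: gx)
    qed
    show "x \<bullet> g s x \<le> x \<bullet> x" for x
      using h.upper[of x] nn[of x] s by (simp add: gx) (smt (verit) mult_nonneg_nonneg)
  qed
  define \<psi> where "\<psi> s = a \<bullet> (g s ^^ (m - 1)) a" for s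
  define T where "T s = trace_power (g s) m" for s
  define k where "k = real m * c * (a \<bullet> a) / \<delta>"
  define \<psi>' where "\<psi>' s = - c * (\<Sum>j<m - 1. (a \<bullet> (g s ^^ (m - 1 - 1 - j)) a) * (a \<bullet> (g s ^^ j) a))" for s
  have k: "0 \<le> k" using c h.\<delta>_pos by (simp add: k_def)
  have pd: "((\<lambda>s. z \<bullet> (g s ^^ n) y) has_real_derivative
      - c * (\<Sum>j<n. (a \<bullet> (g s ^^ (n - 1 - j)) y) * (z \<bullet> (g s ^^ j) a))) (at s)" for z y n s
    using bounded_linear.has_vector_derivative[OF bounded_linear_inner_right[of z]
        has_vector_derivative_power_path[OF h.lin, where c=c and a=a and m=n and y=y and s=s and X=UNIV]]
    by (simp add: g_def[abs_def] has_real_derivative_iff_has_vector_derivative inner_sum_right)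
  have d\<psi>: "(\<psi> has_real_derivative \<psi>' s) (at s)" for s
    unfolding \<psi>_def[abs_def] \<psi>'_def by (rule pd)
  have dT: "(T has_real_derivative - (c * real m * \<psi> s)) (at s)" if s: "0 \<le> s" "s \<le> 1" for s
  proof -
    interpret g: positive_contraction "g s" \<delta> using pc[OF s] .
    have "(T has_real_derivative
       (\<Sum>e\<in>Basis. - c * (\<Sum>j<m. (a \<bullet> (g s ^^ (m - 1 - j)) e) * (e \<bullet> (g s ^^ j) a)))) (at s)"
      unfolding T_def[abs_def] trace_power_def by (intro DERIV_sum pd)
    also have "(\<Sum>e\<in>Basis. - c * (\<Sum>j<m. (a \<bullet> (g s ^^ (m - 1 - j)) e) * (e \<bullet> (g s ^^ j) a)))
      = - c * (\<Sum>j<m. \<Sum>e\<in>Basis. (a \<bullet> (g s ^^ (m - 1 - j)) e) * (e \<bullet> (g s ^^ j) a))"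
      by (subst sum.swap) (simp add: sum_distrib_left)
    also have "\<dots> = - c * (\<Sum>j<m. \<psi> s)"
      unfolding g.trace_product \<psi>_def by simp
    finally show ?thesis by (simp add: mult.assoc)
  qed
  have \<psi>'_nonpos: "\<psi>' s \<le> 0" and \<psi>'_lower: "- k * \<psi> s \<le> \<psi>' s" if s: "0 \<le> s" "s \<le> 1" for s
  proof -
    interpret g: positive_contraction "g s" \<delta> using pc[OF s] .
    obtain q where q: "m = Suc (Suc (2 * q))"
      using m by (metis evenE mult_Suc_right add_2_eq_Suc not0_implies_Suc mult_0_right less_not_refl)
    have "0 \<le> (\<Sum>j<m - 1. (a \<bullet> (g s ^^ (m - 1 - 1 - j)) a) * (a \<bullet> (g s ^^ j) a))"
      by (intro sum_nonneg mult_nonneg_nonneg g.moment_nonneg)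
    then show "\<psi>' s \<le> 0" using c by (simp add: \<psi>'_def)
    have "(\<Sum>j<m - 1. (a \<bullet> (g s ^^ (m - 1 - 1 - j)) a) * (a \<bullet> (g s ^^ j) a))
      \<le> (\<Sum>j<m - 1. (a \<bullet> a) * (a \<bullet> (g s ^^ (2 * q)) a))"
    proof (rule sum_mono)
      fix j assume "j \<in> {..<m - 1}"
      then have "m - 1 - 1 - j + j = 2 * q" by (simp add: q)
      then show "(a \<bullet> (g s ^^ (m - 1 - 1 - j)) a) * (a \<bullet> (g s ^^ j) a)
        \<le> (a \<bullet> a) * (a \<bullet> (g s ^^ (2 * q)) a)"
        using g.moment_mult_le[of a "m - 1 - 1 - j" j] by simp
    qed
    also have "\<dots> \<le> real m * ((a \<bullet> a) * (a \<bullet> (g s ^^ (2 * q)) a))"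
      using m g.moment_nonneg[of a "2 * q"] by (simp add: of_nat_diff mult_right_mono)
    also have "\<dots> \<le> real m * ((a \<bullet> a) * (\<psi> s / \<delta>))"
      using g.moment_Suc_lower[of a q] h.\<delta>_pos
      by (intro mult_left_mono) (auto simp: \<psi>_def q field_simps)
    finally have "c * (\<Sum>j<m - 1. (a \<bullet> (g s ^^ (m - 1 - 1 - j)) a) * (a \<bullet> (g s ^^ j) a)) \<le> c * (real m * ((a \<bullet> a) * (\<psi> s / \<delta>)))"
      using c by (rule mult_left_mono)
    also have "\<dots> = k * \<psi> s" by (simp add: k_def)
    finally show "- k * \<psi> s \<le> \<psi>' s" by (simp add: \<psi>'_def)
  qed
  have \<psi>_le: "\<psi> s \<le> \<psi> 0" if s: "0 \<le> s" "s \<le> 1" for s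
  proof (rule DERIV_nonpos_imp_nonincreasing[OF s(1)])
    fix x assume "0 \<le> x" "x \<le> s"
    then show "\<exists>y. (\<psi> has_real_derivative y) (at x) \<and> y \<le> 0"
      using d\<psi>[of x] \<psi>'_nonpos[of x] s by (intro exI[of _ "\<psi>' x"]) auto
  qed
  have \<psi>_ge: "\<psi> 0 * (1 - k * s) \<le> \<psi> s" if s: "0 \<le> s" "s \<le> 1" for s
  proof -
    have "\<psi> 0 - \<psi> 0 * (1 - k * 0) \<le> \<psi> s - \<psi> 0 * (1 - k * s)"
    proof (rule DERIV_nonneg_imp_nondecreasing[OF s(1)])
      fix x assume x: "0 \<le> x" "x \<le> s"
      have "((\<lambda>s. \<psi> s - \<psi> 0 * (1 - k * s)) has_real_derivative \<psi>' x + k * \<psi> 0) (at x)"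
        by (auto intro!: derivative_eq_intros d\<psi>)
      moreover have "k * \<psi> x \<le> k * \<psi> 0" using \<psi>_le[of x] x s k by (intro mult_left_mono) auto
      then have "0 \<le> \<psi>' x + k * \<psi> 0" using \<psi>'_lower[of x] x s by simp
      ultimately show "\<exists>y. ((\<lambda>s. \<psi> s - \<psi> 0 * (1 - k * s)) has_real_derivative y) (at x) \<and> 0 \<le> y"
        by blast
    qed
    then show ?thesis by simp
  qed
  have "T 1 + real m * c * \<psi> 0 * (1 - k * 1\<^sup>2 / 2) \<le> T 0 + real m * c * \<psi> 0 * (0 - k * 0\<^sup>2 / 2)"
  proof (rule DERIV_nonpos_imp_nonincreasing[of 0 1 "\<lambda>s. T s + real m * c * \<psi> 0 * (s - k * s\<^sup>2 / 2)"])
    fix x :: real assume x: "0 \<le> x" "x \<le> 1"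
    have "((\<lambda>s. T s + real m * c * \<psi> 0 * (s - k * s\<^sup>2 / 2)) has_real_derivative
        - (c * real m * \<psi> x) + real m * c * \<psi> 0 * (1 - k * x)) (at x)"
      by (auto intro!: derivative_eq_intros dT x)
    moreover have "c * real m * (\<psi> 0 * (1 - k * x)) \<le> c * real m * \<psi> x"
      using \<psi>_ge[OF x] c by (intro mult_left_mono) auto
    then have "- (c * real m * \<psi> x) + real m * c * \<psi> 0 * (1 - k * x) \<le> 0" by (simp add: mult_ac)
    ultimately show "\<exists>y. ((\<lambda>s. T s + real m * c * \<psi> 0 * (s - k * s\<^sup>2 / 2)) has_real_derivative y) (at x) \<and> y \<le> 0"
      by blast
  qed simp
  then have "T 1 \<le> T 0 - real m * c * (1 - k / 2) * \<psi> 0" by (simp add: algebra_simps)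
  also have "\<dots> \<le> T 0 - real m * c * (1 - k / 2) * (a \<bullet> (h ^^ m) a)"
  proof -
    obtain q where q: "m = Suc (Suc (2 * q))"
      using m by (metis evenE mult_Suc_right add_2_eq_Suc not0_implies_Suc mult_0_right less_not_refl)
    have "a \<bullet> (h ^^ m) a \<le> \<psi> 0"
      unfolding \<psi>_def g0 q using h.moment_decreasing[of a q] by (simp only: diff_Suc_1)
    moreover have "k \<le> 2" using small h.\<delta>_pos by (simp add: k_def field_simps)
    then have "0 \<le> real m * c * (1 - k / 2)" using c by simp
    ultimately show ?thesis by (intro diff_left_mono mult_left_mono) auto
  qed
  finally show ?thesis by (simp add: T_def g0 g1 k_def mult_ac)
qed

section \<open>Contractions built from the rows of a matrix\<close>

definition shrink :: "real \<Rightarrow> nat \<Rightarrow> (nat \<Rightarrow> 'a::euclidean_space) \<Rightarrow> 'a \<Rightarrow> 'a" where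
  "shrink c n a z = z - c *\<^sub>R (\<Sum>k=1..n. (a k \<bullet> z) *\<^sub>R a k)"

lemma shrink_0: "shrink c 0 a = (\<lambda>z. z)"
  by (simp add: shrink_def fun_eq_iff)

lemma shrink_Suc:
  "shrink c (Suc n) a = (\<lambda>z. shrink c n a z - (c * (a (Suc n) \<bullet> z)) *\<^sub>R a (Suc n))"
  by (simp add: shrink_def fun_eq_iff algebra_simps)

lemma shrink_cong: "(\<And>k. k \<in> {1..n} \<Longrightarrow> a k = b k) \<Longrightarrow> shrink c n a = shrink c n b"
  by (simp add: shrink_def fun_eq_iff)

lemma inner_shrink: "x \<bullet> shrink c n a x = x \<bullet> x - c * (\<Sum>k=1..n. (a k \<bullet> x)\<^sup>2)"
  by (simp add: shrink_def inner_diff_right inner_sum_right power2_eq_square inner_commute)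

lemma shrink_positive_contraction:
  fixes a :: "nat \<Rightarrow> 'a::euclidean_space"
  assumes c: "0 \<le> c" and \<delta>: "0 < \<delta>" and R: "\<And>k. k \<in> {1..n} \<Longrightarrow> a k \<bullet> a k \<le> R"
    and small: "c * (real n * R) \<le> 1 - \<delta>"
  shows "positive_contraction (shrink c n a) \<delta>"
proof (rule positive_contraction.intro)
  show "linear (shrink c n a)"
    by (intro linearI)
      (simp_all add: shrink_def inner_add_right scaleR_add_left sum.distrib scaleR_add_right
        scaleR_diff_right scaleR_sum_right mult_ac)
  show "shrink c n a x \<bullet> y = x \<bullet> shrink c n a y" for x y
    by (simp add: shrink_def inner_diff_left inner_diff_right inner_sum_left inner_sum_right)
      (simp add: inner_commute mult.commute)
  show "0 < \<delta>" by (fact \<delta>)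
  have nn: "0 \<le> (\<Sum>k=1..n. (a k \<bullet> x)\<^sup>2)" for x by (intro sum_nonneg) simp
  show "x \<bullet> shrink c n a x \<le> x \<bullet> x" for x
    using c nn[of x] by (simp add: inner_shrink)
  show "\<delta> * (x \<bullet> x) \<le> x \<bullet> shrink c n a x" for x
  proof -
    have "(\<Sum>k=1..n. (a k \<bullet> x)\<^sup>2) \<le> (\<Sum>k=1..n. R * (x \<bullet> x))"
    proof (rule sum_mono)
      fix k assume "k \<in> {1..n}"
      then show "(a k \<bullet> x)\<^sup>2 \<le> R * (x \<bullet> x)"
        using Cauchy_Schwarz_ineq[of "a k" x] R[of k]
        by (meson inner_ge_zero mult_right_mono order.trans)
    qed
    then have "c * (\<Sum>k=1..n. (a k \<bullet> x)\<^sup>2) \<le> c * (real n * R) * (x \<bullet> x)"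
      using c by (simp add: mult_left_mono mult.assoc)
    also have "\<dots> \<le> (1 - \<delta>) * (x \<bullet> x)" using small by (intro mult_right_mono) auto
    finally show ?thesis by (simp add: inner_shrink algebra_simps)
  qed
qed

text \<open>
  If the quadratic form of the Gram operator were below \<open>s\<close> at a unit vector, that vector alone
  would contribute at least \<open>(1 - c * s) ^ (2 * q)\<close> to the trace.  Replacing the event that the
  Gram operator is badly conditioned by a statement about the trace also makes it evidently
  measurable, the trace being a polynomial in the rows.
\<close>
lemma coercive_of_trace_power_less:
  fixes a :: "nat \<Rightarrow> 'a::euclidean_space"
  assumes "positive_contraction (shrink c n a) \<delta>" and cs: "c * s \<le> 1" and c: "0 \<le> c"
    and less: "trace_power (shrink c n a) (2 * q) < (1 - c * s) ^ (2 * q)"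
  shows "s * (u \<bullet> u) \<le> (\<Sum>k=1..n. (a k \<bullet> u)\<^sup>2)"
proof (rule ccontr)
  interpret positive_contraction "shrink c n a" \<delta> by fact
  assume neg: "\<not> ?thesis"
  then have u: "u \<noteq> 0" by auto
  define e where "e = (1 / norm u) *\<^sub>R u"
  have e: "norm e = 1" using u by (simp add: e_def)
  have "(\<Sum>k=1..n. (a k \<bullet> e)\<^sup>2) = (1 / norm u)\<^sup>2 * (\<Sum>k=1..n. (a k \<bullet> u)\<^sup>2)"
    by (simp add: e_def power_divide sum_divide_distrib)
  also have "\<dots> \<le> (1 / norm u)\<^sup>2 * (s * (u \<bullet> u))"
    using neg by (intro mult_left_mono) auto
  also have "\<dots> = s" using u by (simp add: power2_norm_eq_inner power_divide)
  finally have "c * (\<Sum>k=1..n. (a k \<bullet> e)\<^sup>2) \<le> c * s" using c by (rule mult_left_mono)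
  then have "1 - c * s \<le> e \<bullet> shrink c n a e"
    using e by (simp add: inner_shrink norm_eq_1)
  then have "(1 - c * s) ^ (2 * q) \<le> (e \<bullet> shrink c n a e) ^ (2 * q)"
    using cs by (intro power_mono) auto
  also have "\<dots> \<le> e \<bullet> (shrink c n a ^^ (2 * q)) e" using e by (rule moment_power_le)
  also have "\<dots> \<le> trace_power (shrink c n a) (2 * q)" using e by (rule moment_le_trace)
  finally show False using less by simp
qed

lemma measurable_shrink_power:
  fixes A :: "nat \<Rightarrow> 'w \<Rightarrow> 'a::euclidean_space"
  assumes [measurable]: "\<And>k. k \<in> {1..n} \<Longrightarrow> A k \<in> borel_measurable M"
    and [measurable]: "y \<in> borel_measurable M"
  shows "(\<lambda>w. (shrink c n (\<lambda>k. A k w) ^^ m) (y w)) \<in> borel_measurable M"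
proof (induction m)
  case (Suc m)
  define z where "z w = (shrink c n (\<lambda>k. A k w) ^^ m) (y w)" for w
  have [measurable]: "z \<in> borel_measurable M" using Suc.IH by (simp add: z_def[abs_def])
  have "(\<lambda>w. shrink c n (\<lambda>k. A k w) (z w)) \<in> borel_measurable M"
    unfolding shrink_def
    by (intro borel_measurable_diff borel_measurable_scaleR borel_measurable_sum
        borel_measurable_inner borel_measurable_const) (auto intro: assms)
  then show ?case by (simp add: z_def)
qed simp

lemma measurable_trace_power_shrink:
  fixes A :: "nat \<Rightarrow> 'w \<Rightarrow> 'a::euclidean_space"
  assumes "\<And>k. k \<in> {1..n} \<Longrightarrow> A k \<in> borel_measurable M"
  shows "(\<lambda>w. trace_power (shrink c n (\<lambda>k. A k w)) m) \<in> borel_measurable M"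
  unfolding trace_power_def
  by (intro borel_measurable_sum borel_measurable_inner borel_measurable_const
      measurable_shrink_power assms)

section \<open>The expected trace of a power\<close>

context prob_space
begin

text \<open>
  Conditionally on \<open>Z\<close>, only the second moments of \<open>X\<close> matter; independence turns this into an
  application of the Fubini theorem.
\<close>
lemma expectation_inner_square_lower:
  fixes X Z :: "'a \<Rightarrow> 'b::euclidean_space"
  assumes ind: "indep_var borel X borel Z"
    and X: "AE w in M. X w \<bullet> X w \<le> R" and Z: "AE w in M. Z w \<bullet> Z w \<le> B"
    and \<sigma>: "0 \<le> \<sigma>" "\<And>z. \<sigma> * (z \<bullet> z) \<le> expectation (\<lambda>w. (X w \<bullet> z)\<^sup>2)"
  shows "\<sigma> * expectation (\<lambda>w. Z w \<bullet> Z w) \<le> expectation (\<lambda>w. (X w \<bullet> Z w)\<^sup>2)"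
proof -
  have [measurable]: "X \<in> borel_measurable M" "Z \<in> borel_measurable M"
    using ind indep_var_rv1 indep_var_rv2 by auto
  have bound: "(x \<bullet> z)\<^sup>2 \<le> R * B'" if "x \<bullet> x \<le> R" "z \<bullet> z \<le> B'" for x z :: 'b and B'
    using Cauchy_Schwarz_ineq[of x z] that
    by (meson inner_ge_zero mult_mono order.trans)
  have iXZ: "integrable M (\<lambda>w. (X w \<bullet> Z w)\<^sup>2)"
    using X Z by (intro integrable_const_bound[of _ "R * B"]) (auto elim: eventually_elim2 intro: bound)
  have iX: "integrable M (\<lambda>w. (X w \<bullet> z)\<^sup>2)" for z
    using X bound by (intro integrable_const_bound[of _ "R * (z \<bullet> z)"])
      (auto elim!: eventually_mono intro: bound)
  have iZ: "integrable M (\<lambda>w. Z w \<bullet> Z w)"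
    using Z by (intro integrable_const_bound[of _ B]) auto
  interpret X: prob_space "distr M borel X" by (rule prob_space_distr) simp
  interpret Z: prob_space "distr M borel Z" by (rule prob_space_distr) simp
  interpret XZ: pair_sigma_finite "distr M borel X" "distr M borel Z" ..
  have "ennreal (\<sigma> * expectation (\<lambda>w. Z w \<bullet> Z w)) = (\<integral>\<^sup>+w. ennreal (\<sigma> * (Z w \<bullet> Z w)) \<partial>M)"
    using iZ \<sigma>(1) by (subst nn_integral_eq_integral) auto
  also have "\<dots> \<le> (\<integral>\<^sup>+w. (\<integral>\<^sup>+v. ennreal ((X v \<bullet> Z w)\<^sup>2) \<partial>M) \<partial>M)"
  proof (intro nn_integral_mono)
    fix w
    have "(\<integral>\<^sup>+v. ennreal ((X v \<bullet> Z w)\<^sup>2) \<partial>M) = ennreal (expectation (\<lambda>v. (X v \<bullet> Z w)\<^sup>2))"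
      using iX by (intro nn_integral_eq_integral) auto
    then show "ennreal (\<sigma> * (Z w \<bullet> Z w)) \<le> (\<integral>\<^sup>+v. ennreal ((X v \<bullet> Z w)\<^sup>2) \<partial>M)"
      using \<sigma>(2)[of "Z w"] by (simp add: ennreal_leI)
  qed
  also have "\<dots> = (\<integral>\<^sup>+z. (\<integral>\<^sup>+x. ennreal ((x \<bullet> z)\<^sup>2) \<partial>distr M borel X) \<partial>distr M borel Z)"
    by (subst nn_integral_distr | simp)+
  also have "\<dots> = (\<integral>\<^sup>+p. ennreal ((fst p \<bullet> snd p)\<^sup>2) \<partial>(distr M borel X \<Otimes>\<^sub>M distr M borel Z))"
    by (subst XZ.nn_integral_snd[symmetric]) (auto simp: measurable_split_conv)
  also have "distr M borel X \<Otimes>\<^sub>M distr M borel Z = distr M (borel \<Otimes>\<^sub>M borel) (\<lambda>w. (X w, Z w))"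
    using ind by (simp add: indep_var_distribution_eq)
  also have "(\<integral>\<^sup>+p. ennreal ((fst p \<bullet> snd p)\<^sup>2) \<partial>\<dots>) = (\<integral>\<^sup>+w. ennreal ((X w \<bullet> Z w)\<^sup>2) \<partial>M)"
    by (subst nn_integral_distr) auto
  also have "\<dots> = ennreal (expectation (\<lambda>w. (X w \<bullet> Z w)\<^sup>2))"
    using iXZ by (intro nn_integral_eq_integral) auto
  finally show ?thesis by (simp add: ennreal_le_iff)
qed

text \<open>
  The rank-one update subtracts a multiple of \<open>a \<bullet> (h ^^ m) a\<close>, where \<open>a\<close> is the new row and \<open>h\<close>
  depends on the earlier rows only.  As \<open>h ^^ m\<close> is the square of \<open>h ^^ q\<close>, the average of this
  quantity over \<open>a\<close> is at least \<open>\<sigma>\<close> times the trace itself.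
\<close>
lemma expectation_trace_power_shrink_Suc:
  fixes A :: "nat \<Rightarrow> 'a \<Rightarrow> 'b::euclidean_space"
  assumes indep: "indep_vars (\<lambda>_. borel) A {1..}"
    and bound: "\<And>n. 1 \<le> n \<Longrightarrow> AE w in M. A n w \<bullet> A n w \<le> R"
    and \<sigma>: "0 \<le> \<sigma>" "\<And>n z. 1 \<le> n \<Longrightarrow> \<sigma> * (z \<bullet> z) \<le> expectation (\<lambda>w. (A n w \<bullet> z)\<^sup>2)"
    and c: "0 \<le> c" and \<delta>: "0 < \<delta>" and m: "even m" "0 < m"
    and R: "0 \<le> R" and Suc_small: "c * (real (Suc n) * R) \<le> 1 - \<delta>"
    and step_small: "real m * c * R \<le> 2 * \<delta>"
  shows "expectation (\<lambda>w. trace_power (shrink c (Suc n) (\<lambda>k. A k w)) m)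
    \<le> exp (- (real m * c * (1 - real m * c * R / (2 * \<delta>)) * \<sigma>))
      * expectation (\<lambda>w. trace_power (shrink c n (\<lambda>k. A k w)) m)"
proof -
  define h where "h n w = shrink c n (\<lambda>k. A k w)" for n w
  define T where "T n w = trace_power (h n w) m" for n w
  define \<beta> where "\<beta> = real m * c * (1 - real m * c * R / (2 * \<delta>))"
  obtain q where q: "m = 2 * q" using m by (auto elim: evenE)
  have [measurable]: "A k \<in> borel_measurable M" if "1 \<le> k" for k
    using indep that by (auto simp: indep_vars_def)
  have meas_T [measurable]: "T n \<in> borel_measurable M" for n
    unfolding T_def[abs_def] h_def by (rule measurable_trace_power_shrink) auto
  have all: "AE w in M. \<forall>k\<in>{1..Suc n}. A k w \<bullet> A k w \<le> R"
    by (intro AE_finite_allI) (auto intro: bound)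
  have small: "c * (real n * R) \<le> 1 - \<delta>"
  proof -
    have "c * (real n * R) \<le> c * (real (Suc n) * R)"
      using c R by (intro mult_left_mono mult_right_mono) auto
    then show ?thesis using Suc_small by linarith
  qed
  have pc: "AE w in M. positive_contraction (h n w) \<delta>"
    using all by eventually_elim (auto simp: h_def intro!: shrink_positive_contraction[OF c \<delta> _ small])
  have pc': "AE w in M. positive_contraction (h (Suc n) w) \<delta>"
    using all by eventually_elim (auto simp: h_def intro!: shrink_positive_contraction[OF c \<delta> _ Suc_small])
  have T_bounds: "AE w in M. norm (T i w) \<le> DIM('b)" if "AE w in M. positive_contraction (h i w) \<delta>" for i
    using that
  proof eventually_elim
    fix w assume "positive_contraction (h i w) \<delta>"
    from positive_contraction.trace_power_even_bounds[OF this, of q]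
    show "norm (T i w) \<le> DIM('b)" by (simp add: T_def q)
  qed
  have iT: "integrable M (T n)" and iT': "integrable M (T (Suc n))"
    by (rule integrable_const_bound[OF T_bounds meas_T]; fact)+
  define Q where "Q w = A (Suc n) w \<bullet> (h n w ^^ m) (A (Suc n) w)" for w
  have meas_hq [measurable]: "(\<lambda>w. (h n w ^^ q) e) \<in> borel_measurable M" for e
    unfolding h_def by (rule measurable_shrink_power) auto
  have Q_eq: "AE w in M. Q w = (\<Sum>e\<in>Basis. (A (Suc n) w \<bullet> (h n w ^^ q) e)\<^sup>2)"
    using pc
  proof eventually_elim
    fix w assume "positive_contraction (h n w) \<delta>"
    then interpret positive_contraction "h n w" \<delta> .
    show "Q w = (\<Sum>e\<in>Basis. (A (Suc n) w \<bullet> (h n w ^^ q) e)\<^sup>2)"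
      unfolding Q_def q even_split
      by (subst euclidean_inner) (simp add: power2_eq_square power_self_adjoint)
  qed
  have hq_bound: "AE w in M. (h n w ^^ q) e \<bullet> (h n w ^^ q) e \<le> e \<bullet> e" for e
    using pc by eventually_elim (rule positive_contraction.power_norm_le)
  have iQe: "integrable M (\<lambda>w. (A (Suc n) w \<bullet> (h n w ^^ q) e)\<^sup>2)" for e
  proof (rule integrable_const_bound[of _ "R * (e \<bullet> e)"])
    show "AE w in M. norm ((A (Suc n) w \<bullet> (h n w ^^ q) e)\<^sup>2) \<le> R * (e \<bullet> e)"
      using hq_bound[of e] bound[of "Suc n", simplified]
    proof eventually_elim
      fix w assume "(h n w ^^ q) e \<bullet> (h n w ^^ q) e \<le> e \<bullet> e" "A (Suc n) w \<bullet> A (Suc n) w \<le> R"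
      then have "(A (Suc n) w \<bullet> A (Suc n) w) * ((h n w ^^ q) e \<bullet> (h n w ^^ q) e) \<le> R * (e \<bullet> e)"
        using R by (intro mult_mono) auto
      then show "norm ((A (Suc n) w \<bullet> (h n w ^^ q) e)\<^sup>2) \<le> R * (e \<bullet> e)"
        using Cauchy_Schwarz_ineq[of "A (Suc n) w" "(h n w ^^ q) e"] by simp
    qed
  qed simp
  have meas_Q [measurable]: "Q \<in> borel_measurable M"
    unfolding Q_def[abs_def] h_def
    by (intro borel_measurable_inner measurable_shrink_power) auto
  have iQ: "integrable M Q"
    by (subst integrable_cong_AE[OF meas_Q _ Q_eq]) (auto intro: iQe)
  have lower: "\<sigma> * expectation (T n) \<le> expectation Q"
  proof -
    have hind: "indep_var borel (A (Suc n)) borel (\<lambda>w. (h n w ^^ q) e)" for e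
    proof -
      have "indep_var borel ((\<lambda>f. f (Suc n)) \<circ> (\<lambda>w. restrict (\<lambda>i. A i w) {Suc n}))
          borel ((\<lambda>f. (shrink c n f ^^ q) e) \<circ> (\<lambda>w. restrict (\<lambda>i. A i w) {1..n}))"
      proof (rule indep_var_compose[OF indep_var_restrict[OF indep]])
        show "(\<lambda>f. (shrink c n f ^^ q) e) \<in> borel_measurable (PiM {1..n} (\<lambda>_. borel))"
          using measurable_shrink_power[where n=n and A="\<lambda>k f. f k" and M="PiM {1..n} (\<lambda>_. borel)"
              and y="\<lambda>_. e" and c=c and m=q] by simp
      qed auto
      moreover have "shrink c n (\<lambda>i\<in>{1..n}. A i w) = h n w" for w
        unfolding h_def by (rule shrink_cong) simp
      ultimately show ?thesis by (simp add: comp_def)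
    qed
    have "\<sigma> * expectation (T n) = (\<Sum>e\<in>Basis. \<sigma> * expectation (\<lambda>w. (h n w ^^ q) e \<bullet> (h n w ^^ q) e))"
    proof -
      have "expectation (T n) = expectation (\<lambda>w. \<Sum>e\<in>Basis. (h n w ^^ q) e \<bullet> (h n w ^^ q) e)"
        using pc by (intro integral_cong_AE)
          (auto elim!: eventually_mono simp: T_def q positive_contraction.trace_power_even)
      also have "\<dots> = (\<Sum>e\<in>Basis. expectation (\<lambda>w. (h n w ^^ q) e \<bullet> (h n w ^^ q) e))"
        using hq_bound by (intro Bochner_Integration.integral_sum integrable_const_bound) auto
      finally show ?thesis by (simp add: sum_distrib_left)
    qed
    also have "\<dots> \<le> (\<Sum>e\<in>Basis. expectation (\<lambda>w. (A (Suc n) w \<bullet> (h n w ^^ q) e)\<^sup>2))"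
      by (intro sum_mono expectation_inner_square_lower[OF hind bound hq_bound \<sigma>]) auto
    also have "\<dots> = expectation (\<lambda>w. \<Sum>e\<in>Basis. (A (Suc n) w \<bullet> (h n w ^^ q) e)\<^sup>2)"
      by (intro Bochner_Integration.integral_sum[symmetric] iQe)
    also have "\<dots> = expectation Q"
      using Q_eq by (intro integral_cong_AE) auto
    finally show ?thesis .
  qed
  have "real m * c * R / (2 * \<delta>) \<le> 1" using \<delta> step_small by simp
  then have \<beta>: "0 \<le> \<beta>"
    unfolding \<beta>_def using c by (intro mult_nonneg_nonneg) auto
  have "expectation (T (Suc n)) \<le> expectation (\<lambda>w. T n w - \<beta> * Q w)"
  proof (rule integral_mono_AE)
    show "AE w in M. T (Suc n) w \<le> T n w - \<beta> * Q w"
      using pc pc' bound[of "Suc n", simplified]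
    proof eventually_elim
      fix w assume pcs: "positive_contraction (h n w) \<delta>" "positive_contraction (h (Suc n) w) \<delta>"
        and b: "A (Suc n) w \<bullet> A (Suc n) w \<le> R"
      let ?a = "A (Suc n) w"
      have hS: "h (Suc n) w = (\<lambda>z. h n w z - (c * (?a \<bullet> z)) *\<^sub>R ?a)"
        by (simp add: h_def shrink_Suc)
      have mb: "real m * c * (?a \<bullet> ?a) \<le> real m * c * R" using b c by (intro mult_left_mono) auto
      have "T (Suc n) w \<le> T n w - real m * c * (1 - real m * c * (?a \<bullet> ?a) / (2 * \<delta>)) * Q w"
        using trace_power_rank_one_update[OF pcs(1) pcs(2)[unfolded hS] c m] mb step_small
        by (simp add: T_def hS Q_def)
      also have "\<dots> \<le> T n w - \<beta> * Q w"
      proof -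
        have "0 \<le> Q w" unfolding Q_def by (rule positive_contraction.moment_nonneg[OF pcs(1)])
        moreover have "\<beta> \<le> real m * c * (1 - real m * c * (?a \<bullet> ?a) / (2 * \<delta>))"
          unfolding \<beta>_def using b \<delta> c by (intro mult_left_mono diff_left_mono divide_right_mono) auto
        ultimately show ?thesis by (intro diff_left_mono mult_right_mono)
      qed
      finally show "T (Suc n) w \<le> T n w - \<beta> * Q w" .
    qed
  qed (use iT iT' iQ in auto)
  also have "\<dots> = expectation (T n) - \<beta> * expectation Q"
    using iT iQ by simp
  also have "\<dots> \<le> expectation (T n) - \<beta> * (\<sigma> * expectation (T n))"
    using lower \<beta> by (intro diff_left_mono mult_left_mono)
  also have "\<dots> = (1 + - (\<beta> * \<sigma>)) * expectation (T n)" by (simp add: algebra_simps)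
  also have "\<dots> \<le> exp (- (\<beta> * \<sigma>)) * expectation (T n)"
  proof (rule mult_right_mono[OF exp_ge_add_one_self])
    show "0 \<le> expectation (T n)"
      using pc by (intro integral_nonneg_AE)
        (auto elim!: eventually_mono simp: T_def q positive_contraction.trace_power_even_bounds)
  qed
  finally show ?thesis by (simp add: T_def[abs_def] h_def \<beta>_def)
qed

end

section \<open>A lower tail bound for random Gram matrices\<close>

text \<open>
  The range of \<open>x\<close> fits the choice of parameters in \<open>prob_trace_power_shrink_ge\<close>.
\<close>
lemma exp_le_one_minus:
  fixes x :: real
  assumes "0 \<le> x" "x \<le> 1 / 88"
  shows "exp (- (88 / 87 * x)) \<le> 1 - x"
proof -
  have "inverse (1 - x) = 1 + x / (1 - x)" using assms by (simp add: field_simps)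
  also have "\<dots> \<le> 1 + 88 / 87 * x"
  proof -
    have "88 / 87 * x * (1 - x) \<ge> 88 / 87 * x * (87 / 88)"
      using assms by (intro mult_left_mono) auto
    then show ?thesis using assms by (simp add: field_simps)
  qed
  also have "\<dots> \<le> exp (88 / 87 * x)" by (rule exp_ge_add_one_self)
  finally have "1 \<le> exp (88 / 87 * x) * (1 - x)" using assms by (simp add: field_simps)
  then show ?thesis by (simp add: exp_minus field_simps)
qed

context prob_space
begin

lemma expectation_trace_power_shrink:
  fixes A :: "nat \<Rightarrow> 'a \<Rightarrow> 'b::euclidean_space"
  assumes indep: "indep_vars (\<lambda>_. borel) A {1..}"
    and bound: "\<And>n. 1 \<le> n \<Longrightarrow> AE w in M. A n w \<bullet> A n w \<le> R"
    and \<sigma>: "0 \<le> \<sigma>" "\<And>n z. 1 \<le> n \<Longrightarrow> \<sigma> * (z \<bullet> z) \<le> expectation (\<lambda>w. (A n w \<bullet> z)\<^sup>2)"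
    and c: "0 \<le> c" and \<delta>: "0 < \<delta>" and m: "even m" "0 < m"
    and R: "0 \<le> R" and small: "c * (real n * R) \<le> 1 - \<delta>"
    and step_small: "real m * c * R \<le> 2 * \<delta>"
  shows "expectation (\<lambda>w. trace_power (shrink c n (\<lambda>k. A k w)) m)
    \<le> DIM('b) * exp (- (real n * (real m * c * (1 - real m * c * R / (2 * \<delta>)) * \<sigma>)))"
  using small
proof (induction n)
  case 0
  have "trace_power (\<lambda>z::'b. z) m = DIM('b)"
  proof -
    have "((\<lambda>z::'b. z) ^^ m) = (\<lambda>z. z)" by (induction m) auto
    then show ?thesis by (simp add: trace_power_def inner_same_Basis)
  qed
  then show ?case by (simp add: shrink_0 prob_space)
next
  case (Suc n)
  let ?\<beta> = "real m * c * (1 - real m * c * R / (2 * \<delta>)) * \<sigma>"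
  have "c * (real n * R) \<le> c * (real (Suc n) * R)"
    using c R by (intro mult_left_mono mult_right_mono) auto
  then have IH: "expectation (\<lambda>w. trace_power (shrink c n (\<lambda>k. A k w)) m)
      \<le> DIM('b) * exp (- (real n * ?\<beta>))"
    using Suc by linarith
  have "expectation (\<lambda>w. trace_power (shrink c (Suc n) (\<lambda>k. A k w)) m)
      \<le> exp (- ?\<beta>) * expectation (\<lambda>w. trace_power (shrink c n (\<lambda>k. A k w)) m)"
    using assms Suc.prems by (intro expectation_trace_power_shrink_Suc) auto
  also have "\<dots> \<le> exp (- ?\<beta>) * (DIM('b) * exp (- (real n * ?\<beta>)))"
    using IH by (intro mult_left_mono) auto
  also have "\<dots> = DIM('b) * exp (- ?\<beta> + - (real n * ?\<beta>))"
    by (simp only: exp_add mult_ac)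
  also have "- ?\<beta> + - (real n * ?\<beta>) = - (real (Suc n) * ?\<beta>)"
    by (simp only: of_nat_Suc ring_distribs mult_1_left minus_add_distrib)
  finally show ?case .
qed

text \<open>
  A matrix Chernoff bound.  By \<open>coercive_of_trace_power_less\<close> the event contains the one that
  the least eigenvalue of the Gram operator is below half of its guaranteed mean size \<open>n \<sigma>\<close>.  The exponential rate that \<open>h ^^ m\<close> imitates is
  \<open>m c = 1 / (2 R)\<close>, the optimal one for the quadratic estimate used, and gives the exponent
  \<open>1 / 8\<close> in the limit of small \<open>c\<close>.  The exponent \<open>3 / 28\<close> needed here is smaller, which leaves
  room for the finite value \<open>c = 1 / (44 n R)\<close>, corresponding to \<open>\<delta> = 43 / 44\<close> and \<open>m = 22 n\<close>.
\<close>
lemma prob_trace_power_shrink_ge: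
  fixes A :: "nat \<Rightarrow> 'a \<Rightarrow> 'b::euclidean_space"
  assumes indep: "indep_vars (\<lambda>_. borel) A {1..}"
    and bound: "\<And>n. 1 \<le> n \<Longrightarrow> AE w in M. A n w \<bullet> A n w \<le> R"
    and \<sigma>: "0 \<le> \<sigma>" "\<And>n z. 1 \<le> n \<Longrightarrow> \<sigma> * (z \<bullet> z) \<le> expectation (\<lambda>w. (A n w \<bullet> z)\<^sup>2)"
    and R: "0 < R" "\<sigma> \<le> R" and n: "0 < n"
    and c: "c = 1 / (44 * real n * R)"
  shows "prob {w \<in> space M. (1 - c * (real n * \<sigma> / 2)) ^ (22 * n)
      \<le> trace_power (shrink c n (\<lambda>k. A k w)) (22 * n)}
    \<le> DIM('b) * exp (- (3 / 28 * (real n * \<sigma> / R)))"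
proof -
  define T where "T w = trace_power (shrink c n (\<lambda>k. A k w)) (22 * n)" for w
  define x where "x = c * (real n * \<sigma> / 2)"
  define y where "y = real n * \<sigma> / R"
  have c0: "0 < c" using R n by (simp add: c)
  have cR: "c * (real n * R) = 1 / 44" using R n by (simp add: c)
  have mc: "real (22 * n) * c = 1 / (2 * R)" using R n by (simp add: c)
  have y: "0 \<le> y" using \<sigma> R by (simp add: y_def)
  have x: "x = \<sigma> / R / 88" using R n by (simp add: x_def c)
  have x01: "0 \<le> x" "x \<le> 1 / 88" using \<sigma>(1) R by (auto simp: x)
  have [measurable]: "A k \<in> borel_measurable M" if "1 \<le> k" for k
    using indep that by (auto simp: indep_vars_def)
  have [measurable]: "T \<in> borel_measurable M"
    unfolding T_def[abs_def] by (rule measurable_trace_power_shrink) auto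
  have all: "AE w in M. \<forall>k\<in>{1..n}. A k w \<bullet> A k w \<le> R"
    by (intro AE_finite_allI) (auto intro: bound)
  have T: "AE w in M. 0 \<le> T w \<and> T w \<le> DIM('b)"
    using all
  proof eventually_elim
    fix w assume "\<forall>k\<in>{1..n}. A k w \<bullet> A k w \<le> R"
    then have "positive_contraction (shrink c n (\<lambda>k. A k w)) (43/44)"
      using c0 by (intro shrink_positive_contraction[of c _ n _ R]) (auto simp: cR)
    from positive_contraction.trace_power_even_bounds[OF this, of "11 * n"]
    show "0 \<le> T w \<and> T w \<le> DIM('b)" by (simp add: T_def)
  qed
  have iT: "integrable M T"
    using T by (intro integrable_const_bound[of _ "DIM('b)"]) auto
  have "expectation T \<le> DIM('b) * exp (- (real n * (real (22 * n) * c
      * (1 - real (22 * n) * c * R / (2 * (43/44))) * \<sigma>)))"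
    unfolding T_def[abs_def]
  proof (rule expectation_trace_power_shrink[OF indep bound \<sigma>])
    show "c * (real n * R) \<le> 1 - 43 / 44" by (simp add: cR)
    show "real (22 * n) * c * R \<le> 2 * (43 / 44)" using R by (simp add: mc del: of_nat_mult)
  qed (use c0 R n in auto)
  also have "real n * (real (22 * n) * c * (1 - real (22 * n) * c * R / (2 * (43/44))) * \<sigma>) = 16 / 43 * y"
    using R unfolding mc by (simp add: y_def)
  finally have ET: "expectation T \<le> DIM('b) * exp (- (16 / 43 * y))" .
  have "exp (- (22 / 87 * y)) = exp (- (88 / 87 * x)) ^ (22 * n)"
    by (simp add: x y_def exp_of_nat_mult[symmetric])
  also have "\<dots> \<le> (1 - x) ^ (22 * n)"
    using x01 by (intro power_mono exp_le_one_minus) auto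
  finally have thr: "exp (- (22 / 87 * y)) \<le> (1 - x) ^ (22 * n)" .
  have "prob {w \<in> space M. T w \<ge> (1 - x) ^ (22 * n)} \<le> expectation T / (1 - x) ^ (22 * n)"
    using T x01 by (intro integral_Markov_inequality_measure[OF iT sets.empty_sets]) auto
  also have "\<dots> \<le> (DIM('b) * exp (- (16 / 43 * y))) / exp (- (22 / 87 * y))"
    using ET thr by (intro frac_le) auto
  also have "\<dots> = DIM('b) * exp (- ((16 / 43 - 22 / 87) * y))"
    unfolding times_divide_eq_right[symmetric] exp_diff[symmetric] by (simp add: algebra_simps)
  also have "\<dots> \<le> DIM('b) * exp (- (3 / 28 * y))"
    using y by (intro mult_left_mono) auto
  finally show ?thesis by (simp add: T_def x_def y_def)
qed

end

section \<open>Weighted sums of bounded martingale differences\<close>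

text \<open>
  Hoeffding's lemma for a fair sign, whose moment generating function is \<open>cosh\<close>.
\<close>
lemma cosh_le_exp_square: "cosh x \<le> exp (x\<^sup>2 / 2)" for x :: real
proof -
  have *: "cosh y \<le> exp (y\<^sup>2 / 2)" if "0 \<le> y" for y :: real
  proof -
    have "- (2 * y) * (1 / 2) + ln (1 + (1 / 2) * (exp (2 * y) - 1)) \<le> (2 * y)\<^sup>2 / 8"
      using that by (intro Hoeffdings_lemma_aux) auto
    moreover have "1 + (1 / 2) * (exp (2 * y) - 1) = exp y * cosh y"
      by (simp add: cosh_field_def field_simps exp_minus exp_add[symmetric])
    ultimately have "ln (cosh y) \<le> y\<^sup>2 / 2"
      using cosh_real_pos[of y] by (simp add: ln_mult power2_eq_square)
    then show ?thesis using cosh_real_pos[of y] by (metis exp_le_cancel_iff exp_ln)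
  qed
  show ?thesis using *[of "\<bar>x\<bar>"] by simp
qed

lemma exp_le_chord:
  fixes t y :: real
  assumes "\<bar>t\<bar> \<le> 1"
  shows "exp (y * t) \<le> cosh y + t * sinh y"
proof -
  have "exp ((1 - (1 - t) / 2) *\<^sub>R y + ((1 - t) / 2) *\<^sub>R (- y))
      \<le> (1 - (1 - t) / 2) * exp y + (1 - t) / 2 * exp (- y)"
    using convex_on_exp[of 1] assms
    by (intro convex_onD[where A = UNIV and f = exp]) (auto simp: abs_le_iff)
  also have "\<dots> = cosh y + t * sinh y"
    by (simp add: cosh_field_def sinh_field_def field_simps)
  also have "(1 - (1 - t) / 2) *\<^sub>R y + ((1 - t) / 2) *\<^sub>R (- y) = y * t"
    by (simp add: field_simps)
  finally show ?thesis .
qed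

context prob_space
begin

text \<open>
  Given the past, the chord bound makes the exponential of the next increment affine in that
  increment, whose conditional mean vanishes.  The case \<open>b = 0\<close> is covered because the increments
  vanish and division by zero yields zero.
\<close>
lemma expectation_exp_martingale:
  assumes mds: "martingale_difference M F v"
    and bound: "\<And>n. 1 \<le> n \<Longrightarrow> AE w in M. \<bar>v n w\<bar> \<le> b"
  shows "integrable M (\<lambda>w. exp (\<Sum>n=1..N. c n * v n w)) \<and>
    expectation (\<lambda>w. exp (\<Sum>n=1..N. c n * v n w)) \<le> exp (b\<^sup>2 * (\<Sum>n=1..N. (c n)\<^sup>2) / 2)"
proof (induction N)
  case 0
  then show ?case by (simp add: prob_space)
next
  case (Suc N)
  have filt: "filtration (space M) F" and sub: "\<And>n. subalgebra M (F n)"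
    and vF: "\<And>n. 1 \<le> n \<Longrightarrow> v n \<in> borel_measurable (F n)"
    and iv: "\<And>n. 1 \<le> n \<Longrightarrow> integrable M (v n)"
    and cond: "\<And>n. 1 \<le> n \<Longrightarrow> AE w in M. real_cond_exp M (F (n - 1)) (v n) w = 0"
    using mds by (auto simp: martingale_difference_def)
  have [measurable]: "v n \<in> borel_measurable M" if "1 \<le> n" for n
    using iv[OF that] by auto
  define Z where "Z w = exp (\<Sum>n=1..N. c n * v n w)" for w
  have ZF: "Z \<in> borel_measurable (F N)"
  proof -
    have "v n \<in> borel_measurable (F N)" if "n \<in> {1..N}" for n
      using vF[of n] that filtration.sets_F_mono[OF filt, of n N] filtration.space_F[OF filt]
      by (auto simp: measurable_def)
    then show ?thesis unfolding Z_def[abs_def] by measurable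
  qed
  have [measurable]: "Z \<in> borel_measurable M" by (rule measurable_from_subalg[OF sub ZF])
  have Z0: "0 < Z w" for w by (simp add: Z_def)
  have all: "AE w in M. \<forall>n\<in>{1..Suc N}. \<bar>v n w\<bar> \<le> b"
    by (intro AE_finite_allI) (auto intro: bound)
  have iZ: "integrable M Z" and EZ: "expectation Z \<le> exp (b\<^sup>2 * (\<Sum>n=1..N. (c n)\<^sup>2) / 2)"
    using Suc.IH by (auto simp: Z_def[abs_def])
  have vb: "AE w in M. \<bar>v (Suc N) w\<bar> \<le> b" by (rule bound) simp
  have b0: "0 \<le> b"
  proof -
    have "AE w in M. 0 \<le> b" using vb by eventually_elim linarith
    then show ?thesis by simp
  qed
  have iZv: "integrable M (\<lambda>w. Z w * v (Suc N) w)"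
  proof (rule Bochner_Integration.integrable_bound[of M "\<lambda>w. b * Z w"])
    show "AE w in M. norm (Z w * v (Suc N) w) \<le> norm (b * Z w)"
      using vb by eventually_elim
        (use b0 Z0 in \<open>simp add: abs_mult less_imp_le mult.commute mult_right_mono\<close>)
  qed (use iZ in auto)
  have EZv: "expectation (\<lambda>w. Z w * v (Suc N) w) = 0"
  proof -
    interpret fs: finite_measure_subalgebra M "F N"
      by unfold_locales (rule sub)
    have "expectation (\<lambda>w. Z w * v (Suc N) w)
        = expectation (\<lambda>w. Z w * real_cond_exp M (F N) (v (Suc N)) w)"
      using fs.real_cond_exp_intg(2)[OF iZv ZF] by simp
    also have "\<dots> = expectation (\<lambda>_. 0)"
      using cond[of "Suc N"]
      by (intro integral_cong_AE) (auto intro: measurable_from_subalg[OF sub])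
    finally show ?thesis by simp
  qed
  define y where "y = c (Suc N) * b"
  have chord: "AE w in M. exp (\<Sum>n=1..Suc N. c n * v n w)
      \<le> cosh y * Z w + sinh y / b * (Z w * v (Suc N) w)"
    using vb
  proof eventually_elim
    fix w assume w: "\<bar>v (Suc N) w\<bar> \<le> b"
    have "exp (c (Suc N) * v (Suc N) w) = exp (y * (v (Suc N) w / b))"
      using w by (cases "b = 0") (auto simp: y_def)
    also have "\<dots> \<le> cosh y + v (Suc N) w / b * sinh y"
      using w b0 by (intro exp_le_chord) (cases "b = 0"; simp add: divide_le_eq_1)
    finally have "Z w * exp (c (Suc N) * v (Suc N) w) \<le> Z w * (cosh y + v (Suc N) w / b * sinh y)"
      using Z0[of w] by (intro mult_left_mono) auto
    then show "exp (\<Sum>n=1..Suc N. c n * v n w) \<le> cosh y * Z w + sinh y / b * (Z w * v (Suc N) w)"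
      by (simp add: Z_def exp_add algebra_simps)
  qed
  have iD: "integrable M (\<lambda>w. cosh y * Z w + sinh y / b * (Z w * v (Suc N) w))"
    using iZ iZv by auto
  have i1: "integrable M (\<lambda>w. exp (\<Sum>n=1..Suc N. c n * v n w))"
  proof (rule Bochner_Integration.integrable_bound[OF iD])
    show "AE w in M. norm (exp (\<Sum>n=1..Suc N. c n * v n w))
        \<le> norm (cosh y * Z w + sinh y / b * (Z w * v (Suc N) w))"
      using chord by eventually_elim simp
  qed measurable
  have "expectation (\<lambda>w. exp (\<Sum>n=1..Suc N. c n * v n w))
      \<le> expectation (\<lambda>w. cosh y * Z w + sinh y / b * (Z w * v (Suc N) w))"
    by (rule integral_mono_AE[OF i1 iD chord])
  also have "\<dots> = cosh y * expectation Z" using iZ iZv EZv by simp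
  also have "\<dots> \<le> exp (y\<^sup>2 / 2) * exp (b\<^sup>2 * (\<Sum>n=1..N. (c n)\<^sup>2) / 2)"
    using EZ by (intro mult_mono cosh_le_exp_square)
      (auto intro: integral_nonneg_AE simp: Z_def)
  also have "\<dots> = exp (b\<^sup>2 * (\<Sum>n=1..Suc N. (c n)\<^sup>2) / 2)"
    by (simp add: exp_add[symmetric] y_def field_simps)
  finally show ?case using i1 by blast
qed

text \<open>
  Prescribing the exponent \<open>K\<close>, instead of computing it from \<open>r\<close>, \<open>b\<close> and \<open>C\<close>, avoids a
  division by \<open>b\<close>, which may be zero.
\<close>
lemma Azuma_Hoeffding:
  assumes mds: "martingale_difference M F v"
    and bound: "\<And>n. 1 \<le> n \<Longrightarrow> AE w in M. \<bar>v n w\<bar> \<le> b"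
    and C: "(\<Sum>n=1..N. (c n)\<^sup>2) \<le> C" and K: "0 \<le> K" "2 * b\<^sup>2 * C * K \<le> r\<^sup>2" and r: "0 < r"
  shows "prob {w \<in> space M. r \<le> \<bar>\<Sum>n=1..N. c n * v n w\<bar>} \<le> 2 * exp (- K)"
proof -
  have [measurable]: "v n \<in> borel_measurable M" if "1 \<le> n" for n
    using mds that by (auto simp: martingale_difference_def)
  have one_sided: "prob {w \<in> space M. r \<le> (\<Sum>n=1..N. d n * v n w)} \<le> exp (- K)"
    if D: "(\<Sum>n=1..N. (d n)\<^sup>2) \<le> C" for d
  proof -
    \<comment> \<open>At this value the linear term of the exponent is \<open>- 2 * K\<close> and the quadratic one at most \<open>K\<close>.\<close>
    define l where "l = 2 * K / r"
    have l: "0 \<le> l" using K r by (simp add: l_def)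
    have sum: "(\<Sum>n=1..N. l * d n * v n w) = l * (\<Sum>n=1..N. d n * v n w)" for w
      by (simp add: sum_distrib_left mult.assoc)
    note E = expectation_exp_martingale[OF mds bound, where N = N and c = "\<lambda>n. l * d n", unfolded sum]
    have "prob {w \<in> space M. r \<le> (\<Sum>n=1..N. d n * v n w)}
        \<le> prob {w \<in> space M. exp (l * r) \<le> exp (l * (\<Sum>n=1..N. d n * v n w))}"
      using l by (intro finite_measure_mono) (auto intro: mult_left_mono)
    also have "\<dots> \<le> expectation (\<lambda>w. exp (l * (\<Sum>n=1..N. d n * v n w))) / exp (l * r)"
      using E by (intro integral_Markov_inequality_measure[OF _ sets.empty_sets]) auto
    also have "\<dots> \<le> exp (b\<^sup>2 * (\<Sum>n=1..N. (l * d n)\<^sup>2) / 2) / exp (l * r)"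
      using E by (intro divide_right_mono) auto
    also have "\<dots> = exp (l\<^sup>2 * (b\<^sup>2 * (\<Sum>n=1..N. (d n)\<^sup>2)) / 2 - l * r)"
      by (simp add: exp_diff power_mult_distrib sum_distrib_left mult_ac)
    also have "\<dots> \<le> exp (- K)"
    proof -
      have "l\<^sup>2 * (b\<^sup>2 * (\<Sum>n=1..N. (d n)\<^sup>2)) \<le> l\<^sup>2 * (b\<^sup>2 * C)"
        using D by (intro mult_left_mono) auto
      also have "\<dots> = 2 * K * (2 * b\<^sup>2 * C * K) / r\<^sup>2"
        by (simp add: l_def power2_eq_square)
      also have "\<dots> \<le> 2 * K * r\<^sup>2 / r\<^sup>2"
        using K by (intro divide_right_mono mult_left_mono) auto
      also have "\<dots> = 2 * K" using r by simp
      finally show ?thesis using r by (simp add: l_def)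
    qed
    finally show ?thesis .
  qed
  have "prob {w \<in> space M. r \<le> \<bar>\<Sum>n=1..N. c n * v n w\<bar>}
      \<le> prob ({w \<in> space M. r \<le> (\<Sum>n=1..N. c n * v n w)} \<union> {w \<in> space M. r \<le> (\<Sum>n=1..N. (- c n) * v n w)})"
    by (intro finite_measure_mono) (auto simp: sum_negf abs_real_def split: if_splits)
  also have "\<dots> \<le> prob {w \<in> space M. r \<le> (\<Sum>n=1..N. c n * v n w)}
      + prob {w \<in> space M. r \<le> (\<Sum>n=1..N. (- c n) * v n w)}"
    by (intro measure_Un_le) auto
  also have "\<dots> \<le> exp (- K) + exp (- K)"
    using C by (intro add_mono one_sided) auto
  finally show ?thesis by simp
qed

text \<open>
  Freezing one of two independent variables.  It allows the weights in the noise sum, which depend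
  on the rows, to be treated as constants.
\<close>
lemma prob_le_of_indep_rv:
  assumes ind: "indep_rv M S X T Y" and E: "E \<in> sets (S \<Otimes>\<^sub>M T)"
    and sec: "\<And>y. y \<in> space T \<Longrightarrow> prob {w \<in> space M. (X w, y) \<in> E} \<le> B"
  shows "prob {w \<in> space M. (X w, Y w) \<in> E} \<le> B"
proof -
  have [measurable]: "X \<in> measurable M S" "Y \<in> measurable M T"
    and set: "indep_set {X -` B \<inter> space M | B. B \<in> sets S} {Y -` B \<inter> space M | B. B \<in> sets T}"
    using ind by (auto simp: indep_rv_def)
  interpret X: prob_space "distr M S X" by (rule prob_space_distr) simp
  interpret Y: prob_space "distr M T Y" by (rule prob_space_distr) simp
  interpret XY: pair_sigma_finite "distr M S X" "distr M T Y" ..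
  have joint: "distr M S X \<Otimes>\<^sub>M distr M T Y = distr M (S \<Otimes>\<^sub>M T) (\<lambda>w. (X w, Y w))"
  proof (rule pair_measure_eqI)
    fix A C assume "A \<in> sets (distr M S X)" "C \<in> sets (distr M T Y)"
    then have [measurable]: "A \<in> sets S" "C \<in> sets T" by auto
    have "prob ((X -` A \<inter> space M) \<inter> (Y -` C \<inter> space M)) = prob (X -` A \<inter> space M) * prob (Y -` C \<inter> space M)"
      by (rule indep_setD[OF set]) auto
    moreover have "(\<lambda>w. (X w, Y w)) -` (A \<times> C) \<inter> space M = (X -` A \<inter> space M) \<inter> (Y -` C \<inter> space M)"
      by auto
    ultimately show "emeasure (distr M S X) A * emeasure (distr M T Y) C
        = emeasure (distr M (S \<Otimes>\<^sub>M T) (\<lambda>w. (X w, Y w))) (A \<times> C)"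
      by (simp add: emeasure_distr emeasure_eq_measure ennreal_mult)
  qed (auto intro: X.sigma_finite_measure_axioms Y.sigma_finite_measure_axioms
      simp: sets_pair_measure_cong[OF sets_distr sets_distr])
  have "B \<ge> 0"
  proof -
    obtain w where "w \<in> space M" using not_empty by auto
    then have "Y w \<in> space T" by (rule measurable_space[rotated]) simp
    from sec[OF this] show ?thesis by (rule order.trans[rotated]) simp
  qed
  have "ennreal (prob {w \<in> space M. (X w, Y w) \<in> E})
      = emeasure (distr M (S \<Otimes>\<^sub>M T) (\<lambda>w. (X w, Y w))) E"
    using E by (subst emeasure_distr)
      (auto simp: emeasure_eq_measure vimage_def Int_def conj_commute)
  also have "\<dots> = (\<integral>\<^sup>+y. emeasure (distr M S X) ((\<lambda>x. (x, y)) -` E) \<partial>distr M T Y)"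
    unfolding joint[symmetric] using E
    by (subst XY.emeasure_pair_measure_alt2) (auto simp: sets_pair_measure_cong[OF sets_distr sets_distr])
  also have "\<dots> \<le> (\<integral>\<^sup>+y. ennreal B \<partial>distr M T Y)"
  proof (rule nn_integral_mono)
    fix y assume "y \<in> space (distr M T Y)"
    then have y: "y \<in> space T" by simp
    have "(\<lambda>x. (x, y)) -` E \<in> sets S" using E by (rule sets_Pair2)
    then have "emeasure (distr M S X) ((\<lambda>x. (x, y)) -` E) = ennreal (prob {w \<in> space M. (X w, y) \<in> E})"
      by (subst emeasure_distr) (auto simp: emeasure_eq_measure vimage_def Int_def conj_commute)
    then show "emeasure (distr M S X) ((\<lambda>x. (x, y)) -` E) \<le> ennreal B"
      using sec[OF y] by (simp add: ennreal_leI)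
  qed
  also have "\<dots> = ennreal B" using Y.emeasure_space_1 by simp
  finally show ?thesis using \<open>B \<ge> 0\<close> by simp
qed

end

section \<open>The least squares error\<close>

lemma gram_matrix_vector_mult: "gram_matrix N A *v u = (\<Sum>n=1..N. (A n \<bullet> u) *\<^sub>R A n)"
  by (simp add: vec_eq_iff gram_matrix_def matrix_vector_mult_def inner_vec_def sum_distrib_right
      sum_distrib_left sum.swap[of _ UNIV] mult_ac)

lemma transpose_apply_eq_sum: "transpose_apply N A y = (\<Sum>n=1..N. y n *\<^sub>R A n)"
  by (simp add: vec_eq_iff transpose_apply_def mult.commute)

lemma gram_matrix_self_adjoint:
  "x \<bullet> (gram_matrix N A *v u) = (gram_matrix N A *v x) \<bullet> u"
  by (simp add: gram_matrix_vector_mult inner_sum_left inner_sum_right)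
    (simp add: inner_commute mult.commute)

lemma gram_matrix_cong:
  "(\<And>n. n \<in> {1..N} \<Longrightarrow> A n = B n) \<Longrightarrow> gram_matrix N A = gram_matrix N B"
  by (simp add: gram_matrix_def)

lemma transpose_apply_cong:
  "(\<And>n. n \<in> {1..N} \<Longrightarrow> A n = B n) \<Longrightarrow> (\<And>n. n \<in> {1..N} \<Longrightarrow> y n = z n)
    \<Longrightarrow> transpose_apply N A y = transpose_apply N B z"
  by (simp add: transpose_apply_def)

text \<open>
  The solution of \<open>B *v x = y\<close> as a rational function of the entries.  Unlike \<open>matrix_inv\<close>, it is
  visibly measurable.
\<close>
definition cramer_solution :: "real^'p^'p \<Rightarrow> real^'p \<Rightarrow> real^'p" where
  "cramer_solution B y = (\<chi> k. det (\<chi> i j. if j = k then y $ i else B $ i $ j) / det B)"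

lemma borel_measurable_det:
  fixes B :: "'w \<Rightarrow> real^'p^'p"
  assumes "\<And>i j. (\<lambda>w. B w $ i $ j) \<in> borel_measurable M"
  shows "(\<lambda>w. det (B w)) \<in> borel_measurable M"
  unfolding det_def
  by (intro borel_measurable_sum borel_measurable_times borel_measurable_prod borel_measurable_const assms)

lemma borel_measurable_cramer_solution:
  fixes B :: "'w \<Rightarrow> real^'p^'p"
  assumes "\<And>i j. (\<lambda>w. B w $ i $ j) \<in> borel_measurable M"
    and "\<And>i. (\<lambda>w. y w $ i) \<in> borel_measurable M"
  shows "(\<lambda>w. cramer_solution (B w) (y w) $ k) \<in> borel_measurable M"
proof -
  have "(\<lambda>w. (\<chi> i j. if j = k then y w $ i else B w $ i $ j) $ i $ j) \<in> borel_measurable M" for i j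
    using assms by (cases "j = k") auto
  moreover have "(\<lambda>w. cramer_solution (B w) (y w) $ k)
      = (\<lambda>w. det (\<chi> i j. if j = k then y w $ i else B w $ i $ j) / det (B w))"
    by (simp add: cramer_solution_def)
  ultimately show ?thesis
    by (auto intro!: borel_measurable_divide borel_measurable_det assms(1) simp del: vec_lambda_beta)
qed

context
  fixes N :: nat and a :: "nat \<Rightarrow> real^'p" and s :: real
  assumes s: "0 < s" and coercive: "\<And>u. s * (u \<bullet> u) \<le> (\<Sum>k=1..N. (a k \<bullet> u)\<^sup>2)"
begin

lemma inner_gram_matrix: "u \<bullet> (gram_matrix N a *v u) = (\<Sum>k=1..N. (a k \<bullet> u)\<^sup>2)"
  by (simp add: gram_matrix_vector_mult inner_sum_right power2_eq_square inner_commute)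

lemma invertible_gram_matrix: "invertible (gram_matrix N a)"
proof -
  have "u = 0" if "gram_matrix N a *v u = 0" for u
  proof -
    have "s * (u \<bullet> u) \<le> 0" using coercive[of u] inner_gram_matrix[of u] that by simp
    then have "u \<bullet> u \<le> 0" using s by (simp add: mult_le_0_iff)
    then have "u \<bullet> u = 0" using inner_ge_zero[of u] by linarith
    then show ?thesis by simp
  qed
  then show ?thesis
    by (metis invertible_left_inverse matrix_left_invertible_ker)
qed

lemma gram_matrix_eq_iff_cramer:
  "gram_matrix N a *v x = y \<longleftrightarrow> x = cramer_solution (gram_matrix N a) y"
  unfolding cramer_solution_def
  by (rule cramer) (use invertible_gram_matrix invertible_det_nz in blast)

text \<open>
  The weights are \<open>c n = a n \<bullet> z\<close>, where \<open>z\<close> solves the system with right-hand side the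
  \<open>i\<close>-th unit vector.  Their squares add up to \<open>z \<bullet> (G *v z) = z $ i\<close>, and coercivity
  bounds this by \<open>1 / s\<close>.  Estimating the weights of one coordinate at a time in the Euclidean
  norm is what avoids a factor depending on the dimension.
\<close>
lemma solution_coefficients:
  fixes i :: 'p
  obtains c where "(\<Sum>n=1..N. (c n)\<^sup>2) \<le> 1 / s"
    and "\<And>y. cramer_solution (gram_matrix N a) (transpose_apply N a y) $ i = (\<Sum>n=1..N. c n * y n)"
proof -
  let ?G = "gram_matrix N a"
  define z where "z = cramer_solution ?G (axis i 1)"
  have z: "?G *v z = axis i 1" by (simp add: gram_matrix_eq_iff_cramer z_def)
  have sq: "(\<Sum>n=1..N. (a n \<bullet> z)\<^sup>2) = z $ i"
    using inner_gram_matrix[of z] by (simp add: z inner_axis)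
  have "(z $ i)\<^sup>2 \<le> z \<bullet> z"
  proof -
    have "\<bar>z $ i\<bar>\<^sup>2 \<le> (norm z)\<^sup>2" by (intro power_mono component_le_norm_cart) auto
    then show ?thesis by (simp add: power2_norm_eq_inner)
  qed
  then have "s * (z $ i)\<^sup>2 \<le> s * (z \<bullet> z)" using s by (intro mult_left_mono) auto
  also have "\<dots> \<le> z $ i" using coercive[of z] unfolding sq .
  finally have le: "(s * z $ i) * z $ i \<le> 1 * z $ i" by (simp add: power2_eq_square)
  have "z $ i \<le> 1 / s"
  proof (cases "0 < z $ i")
    case True
    then have "s * z $ i \<le> 1" using le by (simp only: mult_le_cancel_right_pos)
    then show ?thesis using s by (simp add: field_simps)
  next
    case False
    moreover have "0 < 1 / s" using s by simp
    ultimately show ?thesis by linarith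
  qed
  show thesis
  proof (rule that[of "\<lambda>n. a n \<bullet> z"])
    show "(\<Sum>n=1..N. (a n \<bullet> z)\<^sup>2) \<le> 1 / s" using \<open>z $ i \<le> 1 / s\<close> sq by simp
    fix y
    define x where "x = cramer_solution ?G (transpose_apply N a y)"
    have x: "?G *v x = transpose_apply N a y" by (simp add: gram_matrix_eq_iff_cramer x_def)
    have "x $ i = (?G *v z) \<bullet> x" by (simp add: z inner_axis' )
    also have "\<dots> = z \<bullet> transpose_apply N a y" by (simp add: gram_matrix_self_adjoint[symmetric] x)
    also have "\<dots> = (\<Sum>n=1..N. (a n \<bullet> z) * y n)"
      by (simp add: transpose_apply_eq_sum inner_sum_right inner_commute mult.commute)
    finally show "cramer_solution ?G (transpose_apply N a y) $ i = (\<Sum>n=1..N. (a n \<bullet> z) * y n)"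
      by (simp add: x_def)
  qed
qed

lemma least_squares_error:
  assumes "\<And>n. n \<in> {1..N} \<Longrightarrow> x n = a n \<bullet> \<theta> + v n"
  shows "least_squares N a x - \<theta> = cramer_solution (gram_matrix N a) (transpose_apply N a v)"
proof -
  let ?G = "gram_matrix N a"
  have inv: "?G ** matrix_inv ?G = mat 1" "matrix_inv ?G ** ?G = mat 1"
    using invertible_gram_matrix unfolding invertible_def matrix_inv_def by (metis (mono_tags, lifting) someI_ex)+
  have "transpose_apply N a x = (\<Sum>n=1..N. (a n \<bullet> \<theta> + v n) *\<^sub>R a n)"
    unfolding transpose_apply_eq_sum by (rule sum.cong) (auto simp: assms)
  also have "\<dots> = ?G *v \<theta> + transpose_apply N a v"
    by (simp add: transpose_apply_eq_sum gram_matrix_vector_mult scaleR_add_left sum.distrib)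
  finally have "?G *v (least_squares N a x - \<theta>) = transpose_apply N a v"
    by (simp add: least_squares_def matrix_vector_mult_diff_distrib matrix_vector_mul_assoc inv)
  then show ?thesis by (simp add: gram_matrix_eq_iff_cramer)
qed

end

section \<open>Extreme eigenvalues of symmetric matrices\<close>

context
  fixes M :: "real^'p^'p"
  assumes sym: "\<And>x y. x \<bullet> (M *v y) = (M *v x) \<bullet> y"
begin

text \<open>
  Eigenvectors of a symmetric matrix for distinct eigenvalues are orthogonal, so there are at most
  as many as the dimension.  Finiteness gives \<open>Min\<close> and \<open>Max\<close> in \<open>lambda_min\<close> and \<open>lambda_max\<close>
  their meaning.
\<close>
lemma finite_eigenvalues: "finite (eigenvalues M)"
proof -
  have "\<exists>f. \<forall>l\<in>eigenvalues M. f l \<noteq> 0 \<and> M *v f l = l *\<^sub>R f l"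
    by (rule bchoice) (simp add: eigenvalues_def)
  then obtain f where f: "\<And>l. l \<in> eigenvalues M \<Longrightarrow> f l \<noteq> 0 \<and> M *v f l = l *\<^sub>R f l"
    by blast
  have orth: "f l \<bullet> f k = 0" if "l \<in> eigenvalues M" "k \<in> eigenvalues M" "l \<noteq> k" for l k
  proof -
    have "k * (f l \<bullet> f k) = l * (f l \<bullet> f k)"
      using sym[of "f l" "f k"] f that by simp
    then show ?thesis using that by simp
  qed
  have "independent (f ` eigenvalues M)"
    using f orth
    by (intro pairwise_orthogonal_independent) (auto simp: pairwise_def orthogonal_def)
  then have "finite (f ` eigenvalues M)" by (rule independent_imp_finite)
  moreover have "inj_on f (eigenvalues M)"
  proof (rule inj_onI, rule ccontr)
    fix l k assume *: "l \<in> eigenvalues M" "k \<in> eigenvalues M" "f l = f k" "l \<noteq> k"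
    then show False using orth[of l k] f[of k] by auto
  qed
  ultimately show ?thesis by (rule finite_imageD)
qed

text \<open>
  The least value \<open>l\<close> of the quadratic form on the unit sphere is attained at an eigenvector:
  moving the minimiser \<open>u\<close> along \<open>- (M *v u - l *\<^sub>R u)\<close> would otherwise decrease it further.
\<close>
lemma exists_least_eigenvalue:
  obtains l where "l \<in> eigenvalues M" and "\<And>x. l * (x \<bullet> x) \<le> x \<bullet> (M *v x)"
proof -
  have cont: "continuous_on (sphere 0 1) (\<lambda>x. x \<bullet> (M *v x))"
    by (intro continuous_intros linear_continuous_on matrix_vector_mul_bounded_linear)
  have "axis undefined 1 \<in> sphere (0 :: real^'p) 1" by (simp add: norm_axis_1)
  then have "sphere (0 :: real^'p) 1 \<noteq> {}" by blast
  from continuous_attains_inf[OF compact_sphere this cont]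
  obtain u where u: "norm u = 1" and least: "\<And>x. norm x = 1 \<Longrightarrow> u \<bullet> (M *v u) \<le> x \<bullet> (M *v x)"
    by auto
  define l where "l = u \<bullet> (M *v u)"
  have lower: "l * (x \<bullet> x) \<le> x \<bullet> (M *v x)" for x
  proof (cases "x = 0")
    case False
    have "l \<le> ((1 / norm x) *\<^sub>R x) \<bullet> (M *v ((1 / norm x) *\<^sub>R x))"
      unfolding l_def using False by (intro least) simp
    also have "\<dots> = (x \<bullet> (M *v x)) / (norm x)\<^sup>2"
      by (simp add: matrix_vector_mult_scaleR power2_eq_square)
    finally show ?thesis using False by (simp add: field_simps power2_norm_eq_inner)
  qed simp
  define g where "g = M *v u - l *\<^sub>R u"
  define G where "G = g \<bullet> g"
  define \<beta> where "\<beta> = g \<bullet> (M *v g) - l * (g \<bullet> g)"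
  have uu: "u \<bullet> u = 1" using u by (simp add: norm_eq_1)
  have l_uu: "u \<bullet> (M *v u) = l" by (simp add: l_def)
  have gM: "g \<bullet> (M *v u) = u \<bullet> (M *v g)" using sym[of g u] by (simp add: inner_commute)
  have G: "G = g \<bullet> (M *v u) - l * (u \<bullet> g)"
  proof -
    have "G = g \<bullet> (M *v u - l *\<^sub>R u)" by (simp add: G_def g_def)
    then show ?thesis by (simp add: inner_diff_right inner_commute)
  qed
  have quad: "0 \<le> 2 * t * G + t\<^sup>2 * \<beta>" for t
  proof -
    have "l * ((u + t *\<^sub>R g) \<bullet> (u + t *\<^sub>R g)) \<le> (u + t *\<^sub>R g) \<bullet> (M *v (u + t *\<^sub>R g))"
      by (rule lower)
    then show ?thesis
      by (simp add: matrix_vector_right_distrib matrix_vector_mult_scaleR inner_add_left inner_add_right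
          gM[symmetric] uu l_uu inner_commute[of g u] G \<beta>_def power2_eq_square algebra_simps)
  qed
  have \<beta>: "0 \<le> \<beta>" using lower[of g] by (simp add: \<beta>_def)
  have "G = 0"
  proof (rule ccontr)
    assume "G \<noteq> 0"
    define t where "t = - G / (\<beta> + 1)"
    have t: "G = - t * (\<beta> + 1)" "t \<noteq> 0" using \<beta> \<open>G \<noteq> 0\<close> by (auto simp: t_def)
    have "2 * t * G + t\<^sup>2 * \<beta> = - (t\<^sup>2 * (\<beta> + 2))"
      by (simp add: t(1) power2_eq_square algebra_simps)
    also have "\<dots> < 0" using t(2) \<beta> by simp
    finally show False using quad[of t] by simp
  qed
  then have "M *v u = l *\<^sub>R u" by (simp add: G_def g_def)
  moreover have "u \<noteq> 0" using u by auto
  ultimately have "l \<in> eigenvalues M" by (auto simp: eigenvalues_def)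
  then show thesis using lower by (rule that)
qed

lemma lambda_min_quadratic_form: "lambda_min M * (x \<bullet> x) \<le> x \<bullet> (M *v x)"
proof -
  obtain l where l: "l \<in> eigenvalues M" "\<And>x. l * (x \<bullet> x) \<le> x \<bullet> (M *v x)"
    by (rule exists_least_eigenvalue) blast
  have "lambda_min M \<le> l" unfolding lambda_min_def using finite_eigenvalues l(1) by (rule Min_le)
  then have "lambda_min M * (x \<bullet> x) \<le> l * (x \<bullet> x)" by (intro mult_right_mono) auto
  then show ?thesis using l(2)[of x] by linarith
qed

lemma lambda_min_le_lambda_max: "lambda_min M \<le> lambda_max M"
proof -
  obtain l where "l \<in> eigenvalues M" by (rule exists_least_eigenvalue)
  then have "lambda_min M \<le> l" "l \<le> lambda_max M"
    unfolding lambda_min_def lambda_max_def using finite_eigenvalues by (auto intro: Min_le Max_ge)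
  then show ?thesis by linarith
qed

end

lemma integral_matrix_component:
  fixes f :: "'w \<Rightarrow> real^'p^'p"
  assumes "\<And>i j. integrable P (\<lambda>w. f w $ i $ j)"
  shows "(LINT w|P. f w) $ i $ j = (LINT w|P. f w $ i $ j)"
proof -
  have "f w = (\<Sum>i\<in>UNIV. \<Sum>j\<in>UNIV. (f w $ i $ j) *\<^sub>R axis i (axis j 1))" for w
  proof -
    have "(\<Sum>i\<in>UNIV. \<Sum>j\<in>UNIV. (f w $ i $ j) *\<^sub>R axis i (axis j 1) :: real^'p^'p) $ k $ l
        = (\<Sum>i\<in>UNIV. \<Sum>j\<in>UNIV. if k = i then if l = j then f w $ i $ j else 0 else 0)" for k l
      by (simp add: axis_def if_distrib[where f = "\<lambda>x. x $ _"] if_distrib[where f = "\<lambda>x. _ * x"]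
          cong: if_cong)
    moreover have "(\<Sum>i\<in>UNIV. \<Sum>j\<in>UNIV. if k = i then if l = j then f w $ i $ j else 0 else 0)
        = (\<Sum>i\<in>UNIV. if k = i then (\<Sum>j\<in>UNIV. if l = j then f w $ i $ j else 0) else 0)" for k l
      by (intro sum.cong) auto
    moreover have "(\<Sum>i\<in>UNIV. if k = i then (\<Sum>j\<in>UNIV. if l = j then f w $ i $ j else 0) else 0) = f w $ k $ l" for k l by simp
    ultimately show ?thesis by (simp add: vec_eq_iff)
  qed
  moreover have "integrable P (\<lambda>w. \<Sum>i\<in>UNIV. \<Sum>j\<in>UNIV. (f w $ i $ j) *\<^sub>R axis i (axis j 1) :: real^'p^'p)"
    using assms by (intro Bochner_Integration.integrable_sum integrable_scaleR_left)
  ultimately have "integrable P f" by presburger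
  moreover have "bounded_linear (\<lambda>B :: real^'p^'p. B $ i $ j)"
    by (intro bounded_linear_compose[OF bounded_linear_vec_nth bounded_linear_vec_nth])
  ultimately show ?thesis by (rule integral_bounded_linear[symmetric, rotated])
qed

section \<open>Second moments of the rows\<close>

context prob_space
begin

context
  fixes A :: "nat \<Rightarrow> 'a \<Rightarrow> real^'p" and M' :: "real^'p^'p" and \<alpha> :: real
  assumes A_measurable: "\<And>n. n \<ge> 1 \<Longrightarrow> A n \<in> borel_measurable M"
    and A_bound: "\<And>n i. n \<ge> 1 \<Longrightarrow> AE w in M. \<bar>A n w $ i\<bar> \<le> \<alpha>"
    and mean_gram: "\<And>N. N > 0 \<Longrightarrow>
      M' = (1 / real N) *\<^sub>R expectation (\<lambda>w. gram_matrix N (\<lambda>n. A n w))"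
begin

lemma measurable_entry: "n \<ge> 1 \<Longrightarrow> (\<lambda>w. A n w $ i) \<in> borel_measurable M"
  using A_measurable by (auto intro: measurable_compose[OF _ borel_measurable_nth])

lemma integrable_entry_product:
  assumes "n \<ge> 1"
  shows "integrable M (\<lambda>w. A n w $ i * A n w $ j)"
proof (rule integrable_const_bound)
  show "AE w in M. norm (A n w $ i * A n w $ j) \<le> \<alpha> * \<alpha>"
    using A_bound[OF assms, of i] A_bound[OF assms, of j]
    by eventually_elim (auto simp: abs_mult intro!: mult_mono)
  show "(\<lambda>w. A n w $ i * A n w $ j) \<in> borel_measurable M"
    using measurable_entry[OF assms] by measurable
qed

text \<open>
  The mean Gram matrix is assumed for every \<open>N\<close>, so subtracting consecutive values isolates the
  second moments of a single row.
\<close>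
lemma row_covariance:
  assumes "n \<ge> 1"
  shows "expectation (\<lambda>w. A n w $ i * A n w $ j) = M' $ i $ j"
proof -
  let ?g = "\<lambda>n. expectation (\<lambda>w. A n w $ i * A n w $ j)"
  have sum: "(\<Sum>n=1..N. ?g n) = real N * M' $ i $ j" for N
  proof (cases "N = 0")
    case False
    have int: "integrable M (\<lambda>w. gram_matrix N (\<lambda>n. A n w) $ k $ l)" for k l
      unfolding gram_matrix_def vec_lambda_beta
      by (intro Bochner_Integration.integrable_sum integrable_entry_product) auto
    have "real N * M' $ i $ j = expectation (\<lambda>w. gram_matrix N (\<lambda>n. A n w)) $ i $ j"
      using False by (subst mean_gram[of N]) auto
    also have "\<dots> = expectation (\<lambda>w. gram_matrix N (\<lambda>n. A n w) $ i $ j)"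
      using int by (rule integral_matrix_component)
    also have "\<dots> = (\<Sum>n=1..N. ?g n)"
      unfolding gram_matrix_def vec_lambda_beta
      by (intro Bochner_Integration.integral_sum integrable_entry_product) auto
    finally show ?thesis by simp
  qed simp
  obtain k where k: "n = Suc k" using assms by (cases n) auto
  show ?thesis using sum[of n] sum[of k] by (simp add: k algebra_simps)
qed

lemma row_second_moment:
  assumes "n \<ge> 1"
  shows "expectation (\<lambda>w. (A n w \<bullet> z)\<^sup>2) = z \<bullet> (M' *v z)"
proof -
  have "expectation (\<lambda>w. (A n w \<bullet> z)\<^sup>2)
      = expectation (\<lambda>w. \<Sum>i\<in>UNIV. \<Sum>j\<in>UNIV. (z $ i * z $ j) * (A n w $ i * A n w $ j))"
    by (simp add: inner_vec_def power2_eq_square sum_product mult_ac)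
  also have "\<dots> = (\<Sum>i\<in>UNIV. \<Sum>j\<in>UNIV. (z $ i * z $ j) * M' $ i $ j)"
    using integrable_entry_product[OF assms] row_covariance[OF assms]
    by (simp add: Bochner_Integration.integral_sum)
  also have "\<dots> = z \<bullet> (M' *v z)"
    by (simp add: inner_vec_def matrix_vector_mult_def sum_distrib_left mult_ac)
  finally show ?thesis .
qed

lemma covariance_symmetric: "x \<bullet> (M' *v y) = (M' *v x) \<bullet> y"
proof -
  have sym: "M' $ i $ j = M' $ j $ i" for i j
    using row_covariance[of 1 i j] row_covariance[of 1 j i] by (simp add: mult.commute)
  have "x \<bullet> (M' *v y) = (\<Sum>i\<in>UNIV. \<Sum>j\<in>UNIV. M' $ i $ j * (x $ i * y $ j))"
    by (simp add: inner_vec_def matrix_vector_mult_def sum_distrib_left mult_ac)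
  also have "\<dots> = (\<Sum>j\<in>UNIV. \<Sum>i\<in>UNIV. M' $ j $ i * (x $ i * y $ j))"
    by (subst sum.swap) (simp add: sym)
  also have "\<dots> = (M' *v x) \<bullet> y"
    by (simp add: inner_vec_def matrix_vector_mult_def sum_distrib_left sum_distrib_right mult_ac)
  finally show ?thesis .
qed

lemma row_norm_bound:
  assumes "n \<ge> 1"
  shows "AE w in M. A n w \<bullet> A n w \<le> real CARD('p) * \<alpha>\<^sup>2"
proof -
  have "AE w in M. \<forall>i\<in>UNIV. \<bar>A n w $ i\<bar> \<le> \<alpha>"
    by (intro AE_finite_allI) (auto intro: A_bound assms)
  then show ?thesis
  proof eventually_elim
    fix w assume w: "\<forall>i\<in>UNIV. \<bar>A n w $ i\<bar> \<le> \<alpha>"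
    have "A n w \<bullet> A n w = (\<Sum>i\<in>UNIV. \<bar>A n w $ i\<bar>\<^sup>2)"
      by (simp add: inner_vec_def power2_eq_square)
    also have "\<dots> \<le> (\<Sum>i\<in>(UNIV :: 'p set). \<alpha>\<^sup>2)"
      using w by (intro sum_mono power_mono) auto
    finally show "A n w \<bullet> A n w \<le> real CARD('p) * \<alpha>\<^sup>2" by simp
  qed
qed

lemma lambda_min_le_square_bound: "lambda_min M' \<le> \<alpha>\<^sup>2"
proof -
  fix i :: 'p
  have "lambda_min M' * (axis i 1 \<bullet> (axis i 1 :: real^'p)) \<le> axis i 1 \<bullet> (M' *v axis i 1)"
    by (rule lambda_min_quadratic_form[OF covariance_symmetric])
  also have "\<dots> = expectation (\<lambda>w. (A 1 w $ i)\<^sup>2)"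
    using row_second_moment[of 1 "axis i 1"] by (simp add: inner_axis)
  also have "\<dots> \<le> expectation (\<lambda>w. \<alpha>\<^sup>2)"
  proof (rule integral_mono_AE)
    show "integrable M (\<lambda>w. (A 1 w $ i)\<^sup>2)"
      using integrable_entry_product[of 1 i i] by (simp add: power2_eq_square)
    show "AE w in M. (A 1 w $ i)\<^sup>2 \<le> \<alpha>\<^sup>2"
      using A_bound[of 1 i, OF order.refl] by eventually_elim (auto simp: abs_le_square_iff[symmetric])
  qed simp
  finally show ?thesis by (simp add: prob_space inner_axis)
qed

end

end

section \<open>The deviation bound\<close>

context prob_space
begin

text \<open>
  On the event that the rows are bounded and the trace is small, the \<open>i\<close>-th coordinate of the
  error is, for frozen rows, a weighted martingale sum whose squared weights add up to at most
  \<open>1 / s\<close>.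
\<close>
lemma prob_error_component:
  fixes A :: "nat \<Rightarrow> 'a \<Rightarrow> real^'p" and q :: nat and i :: 'p
  assumes ind: "indep_rv M
      (PiM {1..N} (\<lambda>_. borel)) (\<lambda>w. \<lambda>n\<in>{1..N}. v n w)
      (PiM {1..N} (\<lambda>_. borel)) (\<lambda>w. \<lambda>n\<in>{1..N}. A n w)"
    and mds: "martingale_difference M F v"
    and v_bound: "\<And>n. 1 \<le> n \<Longrightarrow> AE w in M. \<bar>v n w\<bar> \<le> b"
    and s: "0 < s" and c: "0 \<le> c" "c * s \<le> 1" and \<delta>: "0 < \<delta>" "c * (real N * R) \<le> 1 - \<delta>"
    and K: "0 \<le> K" "2 * b\<^sup>2 * (1 / s) * K \<le> r\<^sup>2" and r: "0 < r"
  defines "E \<equiv> {w \<in> space M. (\<forall>k\<in>{1..N}. A k w \<bullet> A k w \<le> R)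
      \<and> trace_power (shrink c N (\<lambda>k. A k w)) (2 * q) < (1 - c * s) ^ (2 * q)
      \<and> r < \<bar>cramer_solution (gram_matrix N (\<lambda>k. A k w)) (transpose_apply N (\<lambda>k. A k w) (\<lambda>k. v k w)) $ i\<bar>}"
  shows "E \<in> sets M" and "prob E \<le> 2 * exp (- K)"
proof -
  let ?V = "PiM {1..N} (\<lambda>_. borel) :: (nat \<Rightarrow> real) measure"
  let ?A = "PiM {1..N} (\<lambda>_. borel) :: (nat \<Rightarrow> real^'p) measure"
  define e where "e y a = cramer_solution (gram_matrix N a) (transpose_apply N a y) $ i" for y a
  define G where "G a \<longleftrightarrow> (\<forall>k\<in>{1..N}. a k \<bullet> a k \<le> R)
      \<and> trace_power (shrink c N a) (2 * q) < (1 - c * s) ^ (2 * q)" for a :: "nat \<Rightarrow> real^'p"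
  define D where "D = {p \<in> space (?V \<Otimes>\<^sub>M ?A). G (snd p) \<and> r < \<bar>e (fst p) (snd p)\<bar>}"
  define X where "X w = (\<lambda>n\<in>{1..N}. v n w)" for w
  define Y where "Y w = (\<lambda>n\<in>{1..N}. A n w)" for w
  note ind = ind[folded X_def Y_def]
  have XY_meas [measurable]: "X \<in> measurable M ?V" "Y \<in> measurable M ?A"
    using ind by (auto simp: indep_rv_def)
  have ak [measurable]: "(\<lambda>p. snd p k) \<in> borel_measurable (?V \<Otimes>\<^sub>M ?A)" if "k \<in> {1..N}" for k
    using that by (intro measurable_compose[OF measurable_snd measurable_component_singleton])
  have yk [measurable]: "(\<lambda>p. fst p k) \<in> borel_measurable (?V \<Otimes>\<^sub>M ?A)" if "k \<in> {1..N}" for k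
    using that by (intro measurable_compose[OF measurable_fst measurable_component_singleton])
  have akj [measurable]: "(\<lambda>p. snd p k $ j) \<in> borel_measurable (?V \<Otimes>\<^sub>M ?A)" if "k \<in> {1..N}" for k j
    using ak[OF that] by (rule measurable_compose[OF _ borel_measurable_nth])
  have [measurable]: "(\<lambda>p. e (fst p) (snd p)) \<in> borel_measurable (?V \<Otimes>\<^sub>M ?A)"
    unfolding e_def
    by (intro borel_measurable_cramer_solution)
      (auto simp: gram_matrix_def transpose_apply_def intro!: borel_measurable_sum borel_measurable_times akj yk
        simp del: One_nat_def)
  have [measurable]: "(\<lambda>p. trace_power (shrink c N (snd p)) (2 * q)) \<in> borel_measurable (?V \<Otimes>\<^sub>M ?A)"
    using measurable_trace_power_shrink[where A = "\<lambda>k p. snd p k" and n = N, OF ak] by simp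
  have D: "D \<in> sets (?V \<Otimes>\<^sub>M ?A)" unfolding D_def G_def by measurable
  have XY: "G (Y w) \<longleftrightarrow> G (\<lambda>k. A k w)" "e (X w) (Y w) = e (\<lambda>k. v k w) (\<lambda>k. A k w)" for w
  proof -
    have "shrink c N (Y w) = shrink c N (\<lambda>k. A k w)" by (rule shrink_cong) (simp add: Y_def)
    then show "G (Y w) \<longleftrightarrow> G (\<lambda>k. A k w)" by (simp add: G_def Y_def)
    have "gram_matrix N (Y w) = gram_matrix N (\<lambda>k. A k w)"
      by (rule gram_matrix_cong) (simp add: Y_def)
    moreover have "transpose_apply N (Y w) (X w) = transpose_apply N (\<lambda>k. A k w) (\<lambda>k. v k w)"
      by (rule transpose_apply_cong) (simp_all add: Y_def X_def)
    ultimately show "e (X w) (Y w) = e (\<lambda>k. v k w) (\<lambda>k. A k w)" by (simp add: e_def)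
  qed
  have inD: "(X w, Y w) \<in> D \<longleftrightarrow> G (\<lambda>k. A k w) \<and> r < \<bar>e (\<lambda>k. v k w) (\<lambda>k. A k w)\<bar>" if "w \<in> space M" for w
  proof -
    have "(X w, Y w) \<in> space (?V \<Otimes>\<^sub>M ?A)"
      using measurable_space[OF measurable_Pair[OF XY_meas] that] .
    then show ?thesis by (simp add: D_def XY)
  qed
  have E: "E = {w \<in> space M. (X w, Y w) \<in> D}"
    by (auto simp: inD E_def G_def e_def)
  show "E \<in> sets M" unfolding E using D by measurable
  show "prob E \<le> 2 * exp (- K)"
    unfolding E
  proof (rule prob_le_of_indep_rv[OF ind D])
    fix a assume "a \<in> space ?A"
    show "prob {w \<in> space M. (X w, a) \<in> D} \<le> 2 * exp (- K)"
    proof (cases "G a")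
      case False
      then have empty: "{w \<in> space M. (X w, a) \<in> D} = {}" by (auto simp: D_def)
      show ?thesis unfolding empty by simp
    next
      case True
      have "positive_contraction (shrink c N a) \<delta>"
        using True by (intro shrink_positive_contraction[OF c(1) \<delta>(1) _ \<delta>(2)]) (auto simp: G_def)
      note coercive = coercive_of_trace_power_less[OF this c(2) c(1)]
      have co: "s * (u \<bullet> u) \<le> (\<Sum>k=1..N. (a k \<bullet> u)\<^sup>2)" for u
        using True by (intro coercive[of q]) (simp add: G_def)
      obtain d where d: "(\<Sum>n=1..N. (d n)\<^sup>2) \<le> 1 / s"
        and e: "\<And>y. e y a = (\<Sum>n=1..N. d n * y n)"
        unfolding e_def using solution_coefficients[OF s co] by blast
      have [measurable]: "v n \<in> borel_measurable M" if "1 \<le> n" for n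
        using mds that by (auto simp: martingale_difference_def)
      have "prob {w \<in> space M. (X w, a) \<in> D} \<le> prob {w \<in> space M. r \<le> \<bar>\<Sum>n=1..N. d n * v n w\<bar>}"
      proof (rule finite_measure_mono)
        show "{w \<in> space M. (X w, a) \<in> D} \<subseteq> {w \<in> space M. r \<le> \<bar>\<Sum>n=1..N. d n * v n w\<bar>}"
          by (auto simp: D_def e X_def)
      qed measurable
      also have "\<dots> \<le> 2 * exp (- K)"
        using d K r by (intro Azuma_Hoeffding[OF mds v_bound, where C = "1 / s"]) auto
      finally show ?thesis .
    qed
  qed
qed

end

theorem mainTheorem3:
  fixes P :: "'w measure"
    and A :: "nat \<Rightarrow> 'w \<Rightarrow> real^'p"
    and v x :: "nat \<Rightarrow> 'w \<Rightarrow> real"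
    and \<theta>0 :: "real^'p"
    and M :: "real^'p^'p"
    and F :: "nat \<Rightarrow> 'w measure"
    and \<alpha> b r \<epsilon> :: real
  assumes prob: "prob_space P"
    and model: "\<And>n w. n \<ge> 1 \<Longrightarrow> w \<in> space P \<Longrightarrow> x n w = A n w \<bullet> \<theta>0 + v n w"
    and A_measurable: "\<And>n. n \<ge> 1 \<Longrightarrow> A n \<in> borel_measurable P"
    and rows_indep: "prob_space.indep_vars P (\<lambda>_. borel) A {1..}"
    and zero_mean: "\<And>n. n \<ge> 1 \<Longrightarrow> (LINT w|P. v n w) = 0"
    and A1: "\<And>n i. n \<ge> 1 \<Longrightarrow> \<P>(w in P. \<bar>A n w $ i\<bar> \<le> \<alpha>) = 1"
    and A2: "\<And>N. N > 0 \<Longrightarrow>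
      M = (1 / real N) *\<^sub>R (LINT w|P. gram_matrix N (\<lambda>n. A n w))"
    and A2_pos: "lambda_min M > 0"
    and A6_mds: "martingale_difference P F v"
    and A6_indep: "\<And>N. indep_rv P
      (PiM {1..N} (\<lambda>_. borel)) (\<lambda>w. \<lambda>n\<in>{1..N}. v n w)
      (PiM {1..N} (\<lambda>_. borel)) (\<lambda>w. \<lambda>n\<in>{1..N}. A n w)"
    and A7: "\<And>n. n \<ge> 1 \<Longrightarrow> \<P>(w in P. \<bar>v n w\<bar> \<le> b) = 1"
    and eps: "\<epsilon> > 0"
    and r: "r > 0"
  shows "\<forall>N. N > CARD('p) \<longrightarrow>
      (AE w in P. invertible (gram_matrix N (\<lambda>n. A n w))) \<longrightarrow>
      real N > sample_bound M \<alpha> b r \<epsilon> \<longrightarrow>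
      \<P>(w in P. infnorm (least_squares N (\<lambda>n. A n w) (\<lambda>n. x n w) - \<theta>0) > r) < \<epsilon>"
proof (intro allI impI)
  fix N assume Np: "N > CARD('p)" and Nb: "real N > sample_bound M \<alpha> b r \<epsilon>"
  interpret prob_space P by (rule prob)
  let ?err = "\<lambda>w. infnorm (least_squares N (\<lambda>n. A n w) (\<lambda>n. x n w) - \<theta>0)"
  show "\<P>(w in P. ?err w > r) < \<epsilon>"
  proof (cases "\<epsilon> \<le> 1") \<comment> \<open>For \<open>\<epsilon> > 1\<close> the claim is trivial, while \<open>L\<close> could be negative.\<close>
    case False
    then show ?thesis using prob_le_1[of "{w \<in> space P. ?err w > r}"] by linarith
  next
    case True
    define p where "p = real CARD('p)"
    define \<sigma> where "\<sigma> = lambda_min M"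
    define S where "S = lambda_max M"
    define R where "R = p * \<alpha>\<^sup>2"
    define L where "L = ln (2 * p / \<epsilon>)"
    have A_bound: "AE w in P. \<bar>A n w $ i\<bar> \<le> \<alpha>" if "n \<ge> 1" for n i
      using AE_prob_1[OF A1[OF that, of i]] by eventually_elim simp
    have v_bound: "AE w in P. \<bar>v n w\<bar> \<le> b" if "n \<ge> 1" for n
      using AE_prob_1[OF A7[OF that]] by eventually_elim simp
    note rows = A_measurable A_bound A2
    have sym: "y \<bullet> (M *v z) = (M *v y) \<bullet> z" for y z
      by (rule covariance_symmetric[of A \<alpha>]) (fact rows)+
    have second_moment: "\<sigma> * (z \<bullet> z) \<le> expectation (\<lambda>w. (A n w \<bullet> z)\<^sup>2)" if "1 \<le> n" for n z
      using lambda_min_quadratic_form[OF sym, of z] row_second_moment[of A \<alpha> M n z] rows that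
      by (simp add: \<sigma>_def)
    have A_norm: "AE w in P. A n w \<bullet> A n w \<le> R" if "1 \<le> n" for n
      unfolding R_def p_def by (rule row_norm_bound[of A \<alpha> M]) (use rows that in auto)
    have \<sigma>\<alpha>: "\<sigma> \<le> \<alpha>\<^sup>2"
      unfolding \<sigma>_def by (rule lambda_min_le_square_bound[of A]) (fact rows)+
    have \<sigma>S: "\<sigma> \<le> S" unfolding \<sigma>_def S_def by (rule lambda_min_le_lambda_max[OF sym])
    have \<sigma>: "0 < \<sigma>" using A2_pos by (simp add: \<sigma>_def)
    have p: "1 \<le> p" unfolding p_def by (simp add: Suc_leI)
    have \<sigma>R: "\<sigma> \<le> R"
    proof -
      have "1 * \<alpha>\<^sup>2 \<le> R" unfolding R_def using p by (intro mult_right_mono) auto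
      then show ?thesis using \<sigma>\<alpha> by simp
    qed
    have R: "0 < R" using \<sigma> \<sigma>R by linarith
    have N: "0 < N" using Np by simp
    have Leps: "exp (- L) = \<epsilon> / (2 * p)"
      using eps p by (simp add: L_def exp_minus)
    have L: "0 \<le> L"
    proof -
      have "1 \<le> 2 * p / \<epsilon>" using p True eps by (simp add: field_simps)
      then show ?thesis by (simp add: L_def)
    qed
    have N1: "8 * \<alpha>\<^sup>2 * b\<^sup>2 / (r\<^sup>2 * \<sigma>\<^sup>2) * L < real N"
      and N2: "4 / 3 * ((6 * S + \<sigma>) * (R + S) / \<sigma>\<^sup>2) * L < real N"
      using Nb by (auto simp: sample_bound_def Let_def p_def \<sigma>_def S_def R_def L_def)
    \<comment> \<open>Since \<open>\<sigma> \<le> S\<close>, the second lower bound on \<open>N\<close> exceeds \<open>28 / 3 * (R / \<sigma>) * L\<close>.\<close>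
    have gram_exponent: "L < 3 / 28 * (real N * \<sigma> / R)"
    proof -
      have "7 * \<sigma> * R \<le> (6 * S + \<sigma>) * (R + S)"
        using \<sigma> \<sigma>S R by (intro mult_mono) auto
      then have "7 * \<sigma> * R / \<sigma>\<^sup>2 \<le> (6 * S + \<sigma>) * (R + S) / \<sigma>\<^sup>2"
        by (intro divide_right_mono) auto
      then have "4 / 3 * (7 * \<sigma> * R / \<sigma>\<^sup>2) * L \<le> 4 / 3 * ((6 * S + \<sigma>) * (R + S) / \<sigma>\<^sup>2) * L"
        using L by (intro mult_right_mono mult_left_mono) auto
      then have "28 / 3 * (R / \<sigma>) * L < real N" using N2 \<sigma> by (simp add: power2_eq_square)
      then show ?thesis using R \<sigma> by (simp add: field_simps)
    qed
    \<comment> \<open>The inequality \<open>\<sigma> \<le> \<alpha>\<^sup>2\<close> makes the first lower bound on \<open>N\<close> at least twice as large as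
      an exponent \<open>L\<close> would require, so that \<open>2 * L\<close> is available for the noise.\<close>
    have noise_exponent: "8 * b\<^sup>2 * L \<le> r\<^sup>2 * \<sigma> * real N"
    proof -
      have "8 * b\<^sup>2 * L * \<sigma> \<le> 8 * b\<^sup>2 * L * \<alpha>\<^sup>2"
        using \<sigma>\<alpha> L by (intro mult_left_mono) auto
      also have "\<dots> \<le> r\<^sup>2 * \<sigma>\<^sup>2 * real N"
        using N1 r \<sigma> by (simp add: field_simps)
      finally have "(8 * b\<^sup>2 * L) * \<sigma> \<le> (r\<^sup>2 * \<sigma> * real N) * \<sigma>"
        by (simp add: power2_eq_square mult_ac)
      then show ?thesis using \<sigma> by (simp only: mult_le_cancel_right_pos)
    qed
    define s where "s = real N * \<sigma> / 2"
    define c where "c = 1 / (44 * real N * R)"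
    define thr where "thr = (1 - c * s) ^ (22 * N)"
    have s: "0 < s" using N \<sigma> by (simp add: s_def)
    have c: "0 < c" using N R by (simp add: c_def)
    have cR: "c * (real N * R) = 1 / 44" using N R by (simp add: c_def)
    have cs: "c * s \<le> 1"
    proof -
      have "c * s = \<sigma> / R / 88" using N R by (simp add: c_def s_def)
      also have "\<dots> \<le> 1" using \<sigma>R R \<sigma> by (simp add: field_simps)
      finally show ?thesis .
    qed
    define T where "T w = trace_power (shrink c N (\<lambda>k. A k w)) (22 * N)" for w
    define e where "e w = cramer_solution (gram_matrix N (\<lambda>k. A k w))
      (transpose_apply N (\<lambda>k. A k w) (\<lambda>k. v k w))" for w
    define bad where "bad = {w \<in> space P. thr \<le> T w}"
    define E where "E i = {w \<in> space P. (\<forall>k\<in>{1..N}. A k w \<bullet> A k w \<le> R) \<and> T w < thr \<and> r < \<bar>e w $ i\<bar>}" for i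
    have [measurable]: "T \<in> borel_measurable P"
      unfolding T_def[abs_def] by (rule measurable_trace_power_shrink) (simp add: A_measurable)
    have bad_sets: "bad \<in> sets P" unfolding bad_def by measurable
    have prob_bad: "prob bad < \<epsilon> / 2"
    proof -
      have "prob bad \<le> DIM(real^'p) * exp (- (3 / 28 * (real N * \<sigma> / R)))"
        unfolding bad_def thr_def T_def s_def
        by (rule prob_trace_power_shrink_ge[OF rows_indep A_norm _ second_moment])
          (use \<sigma> R \<sigma>R N c_def in auto)
      also have "\<dots> < p * exp (- L)"
        using gram_exponent p by (simp add: p_def)
      also have "\<dots> = \<epsilon> / 2" using p by (simp add: Leps)
      finally show ?thesis .
    qed
    have E: "E i \<in> sets P" "prob (E i) \<le> 2 * exp (- (2 * L))" for i
    proof -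
      have m: "22 * N = 2 * (11 * N)" by simp
      have K: "0 \<le> 2 * L" "2 * b\<^sup>2 * (1 / s) * (2 * L) \<le> r\<^sup>2"
        using L noise_exponent N \<sigma> by (auto simp: s_def field_simps)
      have \<delta>: "(0::real) < 43 / 44" "c * (real N * R) \<le> 1 - 43 / 44" by (simp_all add: cR)
      note * = prob_error_component[OF A6_indep A6_mds v_bound s less_imp_le[OF c] cs \<delta> K r, of "11 * N" i]
      show "E i \<in> sets P" "prob (E i) \<le> 2 * exp (- (2 * L))"
        using * unfolding E_def T_def e_def thr_def m by auto
    qed
    have "AE w in P. \<forall>k\<in>{1..N}. A k w \<bullet> A k w \<le> R"
      by (intro AE_finite_allI) (auto intro: A_norm)
    then have cover: "AE w in P. w \<in> {w \<in> space P. ?err w > r} \<longrightarrow> w \<in> bad \<union> (\<Union>i. E i)"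
    proof eventually_elim
      fix w assume Aw: "\<forall>k\<in>{1..N}. A k w \<bullet> A k w \<le> R"
      show "w \<in> {w \<in> space P. ?err w > r} \<longrightarrow> w \<in> bad \<union> (\<Union>i. E i)"
      proof (intro impI, rule ccontr)
        assume "w \<in> {w \<in> space P. ?err w > r}"
          and notin: "w \<notin> bad \<union> (\<Union>i. E i)"
        then have w: "w \<in> space P" and err: "?err w > r" by auto
        have T: "T w < thr" using notin w by (auto simp: bad_def)
        have pc: "positive_contraction (shrink c N (\<lambda>k. A k w)) (43 / 44)"
          using Aw c by (intro shrink_positive_contraction[of c _ N _ R]) (auto simp: cR)
        have coercive: "s * (u \<bullet> u) \<le> (\<Sum>k=1..N. (A k w \<bullet> u)\<^sup>2)" for u
          using coercive_of_trace_power_less[OF pc cs, of "11 * N" u] c T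
          by (simp add: T_def thr_def)
        have "least_squares N (\<lambda>n. A n w) (\<lambda>n. x n w) - \<theta>0 = e w"
          unfolding e_def by (rule least_squares_error[OF s coercive]) (simp add: model w)
        moreover have "\<bar>e w $ i\<bar> \<le> r" for i
          using notin w Aw T by (auto simp: E_def not_less)
        then have "infnorm (e w) \<le> r"
          unfolding infnorm_cart by (intro cSup_least) auto
        ultimately show False using err by simp
      qed
    qed
    have "\<P>(w in P. ?err w > r) \<le> prob (bad \<union> (\<Union>i. E i))"
      using cover bad_sets E(1) by (intro finite_measure_mono_AE) auto
    also have "\<dots> \<le> prob bad + prob (\<Union>i. E i)"
      using bad_sets E(1) by (intro measure_Un_le) auto
    also have "prob (\<Union>i. E i) \<le> (\<Sum>i\<in>UNIV. prob (E i))"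
      using E(1) by (intro measure_UNION_le) auto
    also have "\<dots> \<le> (\<Sum>i\<in>(UNIV :: 'p set). 2 * exp (- (2 * L)))"
      by (intro sum_mono E)
    also have "\<dots> = 2 * p * (exp (- L))\<^sup>2"
      by (simp add: p_def exp_double[symmetric] power2_eq_square exp_add[symmetric])
    also have "\<dots> = \<epsilon> / 2 * (\<epsilon> / p)" using p by (simp add: Leps power2_eq_square)
    also have "\<dots> \<le> \<epsilon> / 2 * 1"
      using True p eps by (intro mult_left_mono) auto
    finally show ?thesis using prob_bad by simp
  qed
qed

end
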